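(* Let $k$ be a field (of arbitrary characteristic), $R=k[x_1,\dots,x_n]$, and let $f\in R$ be a polynomial of degree $d$. Then the length of $R_f$ in the category of $D(R,k)$-modules is at most $(d+1)^n$, and the length of $H^1_f(R)$ in the category of $D(R,k)$-modules is at most $(d+1)^n-1$.
   Context: $D(R,k)$ denotes the ring of $k$-linear differential operators on $R$; it is generated over $R$ by the operators $\frac{1}{t!}\frac{\partial^t}{\partial x_i^t}$, $t\ge 0$, $1\le i\le n$. $R_f$ and $H^1_f(R)=R_f/R$ carry natural $D(R,k)$-module structures. *)

theory Defs
  imports "HOL-Library.Poly_Mapping" "HOL-Library.Extended_Nat"
begin

text \<open>Polynomials in the variables x_0, x_1, ... over a field: finitely supported
  maps from monomials (exponent vectors) to coefficients. R = k[x_0..x_(n-1)] is the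
  carrier polys n.\<close>

type_synonym 'k mpoly = "(nat \<Rightarrow>\<^sub>0 nat) \<Rightarrow>\<^sub>0 'k"

definition polys :: "nat \<Rightarrow> 'k::field mpoly set" where
  "polys n = {p. \<forall>m\<in>Poly_Mapping.keys p. Poly_Mapping.keys m \<subseteq> {..<n}}"

text \<open>Total degree (the zero polynomial gets degree 0).\<close>
definition total_deg :: "'k::field mpoly \<Rightarrow> nat" where
  "total_deg p = Max (insert 0 ((\<lambda>m. sum (Poly_Mapping.lookup m) (Poly_Mapping.keys m)) ` Poly_Mapping.keys p))"

text \<open>Divided partial derivative (1/t!) d^t/dx_i^t :
  x^m maps to (m_i choose t) x^(m - t e_i).\<close>
definition dpart :: "nat \<Rightarrow> nat \<Rightarrow> 'k::field mpoly \<Rightarrow> 'k mpoly" where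
  "dpart i t p = (\<Sum>m\<in>Poly_Mapping.keys p. Poly_Mapping.single (m - Poly_Mapping.single i t)
                                 (of_nat (Poly_Mapping.lookup m i choose t) * Poly_Mapping.lookup p m))"

text \<open>Localization R_f: elements g/f^s are represented by pairs (g,s) with g in R.\<close>
definition loc_eq :: "'k::field mpoly \<Rightarrow> 'k mpoly \<times> nat \<Rightarrow> 'k mpoly \<times> nat \<Rightarrow> bool" where
  "loc_eq f p q \<longleftrightarrow> (\<exists>N. f ^ N * (fst p * f ^ snd q - fst q * f ^ snd p) = 0)"

text \<open>H^1_f(R) = R_f / R: two representatives are identified iff their difference lies in R.\<close>
definition hloc_eq :: "'k::field mpoly \<Rightarrow> nat \<Rightarrow> 'k mpoly \<times> nat \<Rightarrow> 'k mpoly \<times> nat \<Rightarrow> bool" where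
  "hloc_eq f n p q \<longleftrightarrow>
     (\<exists>a\<in>polys n. loc_eq f (fst p * f ^ snd q - fst q * f ^ snd p, snd p + snd q) (a, 0))"

definition loc_add :: "'k::field mpoly \<Rightarrow> 'k mpoly \<times> nat \<Rightarrow> 'k mpoly \<times> nat \<Rightarrow> 'k mpoly \<times> nat" where
  "loc_add f p q = (fst p * f ^ snd q + fst q * f ^ snd p, snd p + snd q)"

text \<open>The natural action of the divided derivative on R_f, obtained from the Leibniz rule:
  for h = g/F (F = f^s), P_t = F^(t+1) * d^[t] h satisfies
  P_t = F^t d^[t] g - sum_(j=1..t) d^[j] F * F^(j-1) * P_(t-j).\<close>
function dloc_num :: "nat \<Rightarrow> 'k::field mpoly \<Rightarrow> 'k mpoly \<Rightarrow> nat \<Rightarrow> 'k mpoly" where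
  "dloc_num i F g t = F ^ t * dpart i t g
     - (\<Sum>j\<in>{1..t}. dpart i j F * F ^ (j - 1) * dloc_num i F g (t - j))"
  by pat_completeness auto
termination by (relation "measure (\<lambda>(i, F, g, t). t)") auto

definition dact :: "'k::field mpoly \<Rightarrow> nat \<Rightarrow> nat \<Rightarrow> 'k mpoly \<times> nat \<Rightarrow> 'k mpoly \<times> nat" where
  "dact f i t p = (dloc_num i (f ^ snd p) (fst p) t, snd p * (t + 1))"

text \<open>D(R,k)-submodules of the module of representatives modulo the equivalence E
  (E = loc_eq f for R_f, E = hloc_eq f n for H^1_f(R)), as saturated sets of representatives.
  D(R,k) is generated over R by the divided derivatives, so a D(R,k)-submodule is an
  additive subgroup closed under multiplication by R and under all dact f i t, i < n.\<close>
definition dsubmod ::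
  "('k::field mpoly \<times> nat \<Rightarrow> 'k mpoly \<times> nat \<Rightarrow> bool) \<Rightarrow> 'k mpoly \<Rightarrow> nat
     \<Rightarrow> ('k mpoly \<times> nat) set \<Rightarrow> bool" where
  "dsubmod E f n M \<longleftrightarrow>
     M \<subseteq> polys n \<times> UNIV \<and>
     (\<forall>p\<in>M. \<forall>q\<in>polys n \<times> UNIV. E p q \<longrightarrow> q \<in> M) \<and>
     (0, 0) \<in> M \<and>
     (\<forall>p\<in>M. \<forall>q\<in>M. loc_add f p q \<in> M) \<and>
     (\<forall>a\<in>polys n. \<forall>p\<in>M. (a * fst p, snd p) \<in> M) \<and>
     (\<forall>i<n. \<forall>t. \<forall>p\<in>M. dact f i t p \<in> M)"

definition dlength ::
  "('k::field mpoly \<times> nat \<Rightarrow> 'k mpoly \<times> nat \<Rightarrow> bool) \<Rightarrow> 'k mpoly \<Rightarrow> nat \<Rightarrow> enat" where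
  "dlength E f n = Sup {enat l | l. \<exists>N. (\<forall>j\<le>l. dsubmod E f n (N j)) \<and>
                                          (\<forall>j<l. N j \<subset> N (Suc j))}"

end

theory Submission
  imports Defs "HOL-Computational_Algebra.Fraction_Field"
    "HOL-Computational_Algebra.Formal_Power_Series"
begin

text \<open>
  View \<open>R\<^sub>f\<close> inside the fraction field of the polynomial ring. For \<open>d = deg f\<close> the subspaces
  \<open>V\<^sub>j = {g / f^j. deg g \<le> j (d + 1)}\<close> satisfy \<open>x\<^sub>i V\<^sub>j \<subseteq> V\<^sub>j\<^sub>+\<^sub>1\<close> and \<open>\<partial>\<^sub>i\<^sup>[\<^sup>t\<^sup>] V\<^sub>j \<subseteq> V\<^sub>j\<^sub>+\<^sub>t\<close>, and
  \<open>dim V\<^sub>j \<le> (d + 1)^n N(j)\<close>, where \<open>N(j)\<close> counts the monomials of degree at most \<open>j\<close>.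

  Every proper inclusion \<open>A \<subset> B\<close> of D-submodules contributes at least \<open>N(j - c)\<close> to \<open>dim V\<^sub>j\<close>.
  Choose \<open>w \<in> B - A\<close> whose annihilator \<open>P\<close> modulo \<open>A\<close> is maximal, hence prime. Let \<open>s\<^sub>i\<close> be the
  least \<open>r\<close> such that \<open>\<partial>\<^sub>i\<^sup>[\<^sup>r\<^sup>]\<close> moves some \<open>g\<^sub>i \<in> P \<inter> k[x\<^sub>0,\<dots>,x\<^sub>i]\<close> out of \<open>P\<close>.
  Then the elements obtained from \<open>w\<close> by multiplying with \<open>x\<^sup>r\<close>, where \<open>r\<^sub>i = b\<^sub>i mod s\<^sub>i\<close>, and
  differentiating \<open>b\<^sub>i - r\<^sub>i\<close> times in \<open>x\<^sub>i\<close>, for \<open>b\<close> in \<open>\<nat>\<^sup>n\<close>, are linearly independent modulo \<open>A\<close>: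
  powers of the \<open>g\<^sub>i\<close> strip off the derivatives of a leading term one variable at a time, and
  a polynomial in \<open>P\<close> all of whose exponents satisfy \<open>r\<^sub>i < s\<^sub>i\<close> vanishes.

  Hence a chain of length \<open>l\<close> gives \<open>l N(j) \<le> (d + 1)^n N(j + c)\<close> for all \<open>j\<close>, and
  \<open>l \<le> (d + 1)^n\<close> since \<open>N\<close> grows polynomially. For \<open>R\<^sub>f / R\<close>, put \<open>0 \<subset> R\<close> in front of the chain.
\<close>

section \<open>Polynomials and divided derivatives\<close>

abbreviation "lookup \<equiv> Poly_Mapping.lookup"
abbreviation "keys \<equiv> Poly_Mapping.keys"
abbreviation "single \<equiv> Poly_Mapping.single"

definition mdeg :: "(nat \<Rightarrow>\<^sub>0 nat) \<Rightarrow> nat" where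
  "mdeg m = sum (lookup m) (keys m)"

definition mons :: "nat \<Rightarrow> (nat \<Rightarrow>\<^sub>0 nat) set" where
  "mons n = {m. keys m \<subseteq> {..<n}}"

lemma mons_iff: "m \<in> mons n \<longleftrightarrow> (\<forall>i\<ge>n. lookup m i = 0)"
  unfolding mons_def by (auto simp: in_keys_iff subset_iff) (metis linorder_not_le less_irrefl)

lemma mdeg_superset: "finite S \<Longrightarrow> keys m \<subseteq> S \<Longrightarrow> mdeg m = sum (lookup m) S"
  unfolding mdeg_def by (rule sum.mono_neutral_left) (auto simp: in_keys_iff)

lemma mdeg_mons: "m \<in> mons n \<Longrightarrow> mdeg m = (\<Sum>i<n. lookup m i)"
  by (rule mdeg_superset) (auto simp: mons_def)

lemma mdeg_add: "mdeg (a + b) = mdeg a + mdeg b"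
proof -
  have "mdeg (a + b) = sum (lookup (a + b)) (keys a \<union> keys b)"
    by (rule mdeg_superset) (auto simp: keys_add)
  also have "\<dots> = sum (lookup a) (keys a \<union> keys b) + sum (lookup b) (keys a \<union> keys b)"
    by (simp add: lookup_add sum.distrib)
  also have "sum (lookup a) (keys a \<union> keys b) = mdeg a"
    by (rule mdeg_superset [symmetric]) auto
  also have "sum (lookup b) (keys a \<union> keys b) = mdeg b"
    by (rule mdeg_superset [symmetric]) auto
  finally show ?thesis .
qed

lemma mdeg_zero [simp]: "mdeg 0 = 0"
  by (simp add: mdeg_def)

lemma mdeg_single [simp]: "mdeg (single i t) = t"
  by (simp add: mdeg_def)

lemma zero_in_mons [simp]: "0 \<in> mons n"
  by (simp add: mons_def)

lemma mons_add: "a \<in> mons n \<Longrightarrow> b \<in> mons n \<Longrightarrow> a + b \<in> mons n"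
  by (auto simp: mons_iff lookup_add)

lemma polys_iff: "p \<in> polys n \<longleftrightarrow> keys p \<subseteq> mons n"
  by (auto simp: polys_def mons_def)

definition bpolys :: "nat \<Rightarrow> nat \<Rightarrow> 'k::field mpoly set" where
  "bpolys n e = {p. keys p \<subseteq> {m \<in> mons n. mdeg m \<le> e}}"

lemma bpolys_polys: "p \<in> bpolys n e \<Longrightarrow> p \<in> polys n"
  by (auto simp: bpolys_def polys_iff)

lemma bpolys_total_deg: "p \<in> polys n \<Longrightarrow> p \<in> bpolys n (total_deg p)"
  unfolding bpolys_def polys_iff total_deg_def mdeg_def
  by (auto intro!: Max_ge)

lemma bpolys_mono: "p \<in> bpolys n e \<Longrightarrow> e \<le> e' \<Longrightarrow> p \<in> bpolys n e'"
  by (force simp: bpolys_def)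

lemma bpolys_zero [simp]: "0 \<in> bpolys n e"
  by (simp add: bpolys_def)

lemma bpolys_add: "p \<in> bpolys n e \<Longrightarrow> q \<in> bpolys n e \<Longrightarrow> p + q \<in> bpolys n e"
  unfolding bpolys_def using keys_add [of p q] by blast

lemma bpolys_uminus: "p \<in> bpolys n e \<Longrightarrow> - p \<in> bpolys n e"
  by (simp add: bpolys_def in_keys_iff subset_iff)

lemma bpolys_mult:
  assumes "p \<in> bpolys n e" "q \<in> bpolys n e'"
  shows "p * q \<in> bpolys n (e + e')"
  unfolding bpolys_def
proof safe
  fix m assume "m \<in> keys (p * q)"
  then obtain a b where ab: "a \<in> keys p" "b \<in> keys q" "m = a + b"
    using keys_mult [of p q] by auto
  with assms show "m \<in> mons n" "mdeg m \<le> e + e'"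
    by (auto simp: bpolys_def subset_iff mdeg_add intro!: mons_add add_mono)
qed

lemma bpolys_single: "m \<in> mons n \<Longrightarrow> mdeg m \<le> e \<Longrightarrow> single m c \<in> bpolys n e"
  by (auto simp: bpolys_def)

lemma bpolys_one [simp]: "1 \<in> bpolys n e"
  by (simp add: bpolys_def)

lemma bpolys_power: "p \<in> bpolys n e \<Longrightarrow> p ^ t \<in> bpolys n (t * e)"
  by (induction t) (auto intro: bpolys_mult)

lemma polys_ex_bpolys: "p \<in> polys n \<longleftrightarrow> (\<exists>e. p \<in> bpolys n e)"
  using bpolys_polys bpolys_total_deg by blast

lemma polys_zero [simp]: "0 \<in> polys n"
  and polys_one [simp]: "1 \<in> polys n"
  by (simp_all add: polys_iff)

lemma polys_add: "p \<in> polys n \<Longrightarrow> q \<in> polys n \<Longrightarrow> p + q \<in> polys n"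
  unfolding polys_iff using keys_add [of p q] by blast

lemma polys_mult: "p \<in> polys n \<Longrightarrow> q \<in> polys n \<Longrightarrow> p * q \<in> polys n"
  unfolding polys_ex_bpolys using bpolys_mult by blast

lemma polys_uminus: "p \<in> polys n \<Longrightarrow> - p \<in> polys n"
  unfolding polys_ex_bpolys using bpolys_uminus by blast

lemma polys_diff: "p \<in> polys n \<Longrightarrow> q \<in> polys n \<Longrightarrow> p - q \<in> polys n"
  using polys_add [of p n "- q"] polys_uminus by auto

lemma polys_power: "p \<in> polys n \<Longrightarrow> p ^ t \<in> polys n"
  unfolding polys_ex_bpolys using bpolys_power by blast

lemma polys_single: "m \<in> mons n \<Longrightarrow> single m c \<in> polys n"
  by (auto simp: polys_iff)

lemma polys_sum: "(\<And>x. x \<in> S \<Longrightarrow> g x \<in> polys n) \<Longrightarrow> sum g S \<in> polys n"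
  by (induction S rule: infinite_finite_induct) (auto intro: polys_add)

lemma polys_mono: "p \<in> polys m \<Longrightarrow> m \<le> n \<Longrightarrow> p \<in> polys n"
  by (force simp: polys_iff mons_iff subset_iff)

lemma mpoly_sum_single: "p = (\<Sum>m\<in>keys p. single m (lookup p m))"
  by (rule poly_mapping_eqI)
    (auto simp: lookup_sum lookup_single when_def in_keys_iff sum.delta)

lemma mpoly_induct [case_names single add]:
  fixes p :: "'k::field mpoly"
  assumes "\<And>m c. P (single m c)" "\<And>p q. P p \<Longrightarrow> P q \<Longrightarrow> P (p + q)"
  shows "P p"
proof -
  have "P (\<Sum>m\<in>S. single m (lookup p m))" for S
    by (induction S rule: infinite_finite_induct)
       (auto intro: assms(2) assms(1) simp: assms(1) [of 0 0, simplified])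
  then show ?thesis
    using mpoly_sum_single [of p] by metis
qed

lemma minus_single_eq_iff:
  fixes a m :: "nat \<Rightarrow>\<^sub>0 nat"
  assumes "t \<le> lookup a i"
  shows "a - single i t = m \<longleftrightarrow> a = m + single i t"
proof
  assume "a - single i t = m"
  then have "lookup a j - lookup (single i t) j = lookup m j" for j
    by (metis lookup_minus)
  then show "a = m + single i t"
    using assms by (intro poly_mapping_eqI)
      (auto simp: lookup_add lookup_single when_def split: if_splits; metis diff_zero le_add_diff_inverse2)
qed simp

text \<open>For an exponent below \<open>t\<close> the truncated difference
  \<open>m - single i t\<close> is not the intended monomial, but there the binomial coefficient
  vanishes.\<close>

lemma lookup_dpart:
  "lookup (dpart i t p) m = of_nat ((lookup m i + t) choose t) * lookup p (m + single i t)"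
proof -
  have "lookup (dpart i t p) m =
      (\<Sum>a\<in>keys p. of_nat (lookup a i choose t) * lookup p a when a = m + single i t)"
    unfolding dpart_def lookup_sum lookup_single
  proof (intro sum.cong refl)
    fix a assume "a \<in> keys p"
    show "(of_nat (lookup a i choose t) * lookup p a when a - single i t = m) =
          (of_nat (lookup a i choose t) * lookup p a when a = m + single i t)"
      using minus_single_eq_iff [of t a i m]
      by (cases "t \<le> lookup a i") (auto simp: when_def binomial_eq_0)
  qed
  then show ?thesis
    by (auto simp: when_def sum.delta in_keys_iff lookup_add)
qed

lemma dpart_add: "dpart i t (p + q) = dpart i t p + dpart i t q"
  by (rule poly_mapping_eqI) (simp add: lookup_dpart lookup_add algebra_simps)

lemma dpart_order_zero [simp]: "dpart i 0 p = p"
  by (rule poly_mapping_eqI) (simp add: lookup_dpart)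

lemma dpart_of_zero [simp]: "dpart i t 0 = 0"
  by (rule poly_mapping_eqI) (simp add: lookup_dpart)

lemma dpart_single:
  "dpart i t (single m c) = single (m - single i t) (of_nat (lookup m i choose t) * c)"
  by (cases "c = 0") (simp_all add: dpart_def)

text \<open>Both sides are bilinear, so monomials suffice; for these the identity is Vandermonde's
  convolution of binomial coefficients.\<close>

lemma dpart_mult:
  "dpart i t (p * q) = (\<Sum>a\<le>t. dpart i a p * dpart i (t - a) q)"
proof (induction p rule: mpoly_induct)
  case (single m c)
  show ?case
  proof (induction q rule: mpoly_induct)
    case (single m' c')
    have "dpart i a (single m c) * dpart i (t - a) (single m' c') =
          single (m + m' - single i t)
            (of_nat ((lookup m i choose a) * (lookup m' i choose (t - a))) * (c * c'))"
      if "a \<le> t" for a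
    proof (cases "a \<le> lookup m i \<and> t - a \<le> lookup m' i")
      case True
      have "(m - single i a) + (m' - single i (t - a)) = m + m' - single i t"
        using True that
        by (intro poly_mapping_eqI) (auto simp: lookup_minus lookup_add lookup_single when_def)
      then show ?thesis
        by (simp add: dpart_single mult_single algebra_simps)
    next
      case False
      then have "lookup m i choose a = 0 \<or> lookup m' i choose (t - a) = 0"
        by (auto simp: binomial_eq_0)
      then show ?thesis
        unfolding dpart_single mult_single
        by (elim disjE) (simp_all only: of_nat_0 mult_zero_left mult_zero_right single_zero)
    qed
    then have "(\<Sum>a\<le>t. dpart i a (single m c) * dpart i (t - a) (single m' c')) =
        (\<Sum>a\<le>t. single (m + m' - single i t)
            (of_nat ((lookup m i choose a) * (lookup m' i choose (t - a))) * (c * c')))"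
      by (intro sum.cong) auto
    also have "\<dots> = single (m + m' - single i t)
          (of_nat (\<Sum>a\<le>t. (lookup m i choose a) * (lookup m' i choose (t - a))) * (c * c'))"
      by (rule poly_mapping_eqI)
        (simp add: lookup_sum lookup_single when_def sum_distrib_right)
    finally show ?case
      by (simp add: vandermonde mult_single dpart_single lookup_add)
  next
    case (add q r)
    then show ?case
      by (simp add: dpart_add sum.distrib distrib_left)
  qed
next
  case (add p r)
  then show ?case
    by (simp add: dpart_add sum.distrib distrib_right)
qed

lemma keys_dpart: "m \<in> keys (dpart i t p) \<Longrightarrow> m + single i t \<in> keys p"
  by (auto simp: in_keys_iff lookup_dpart)

lemma bpolys_dpart: "p \<in> bpolys n e \<Longrightarrow> dpart i t p \<in> bpolys n e"
  unfolding bpolys_def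
proof safe
  fix m assume "keys p \<subseteq> {m \<in> mons n. mdeg m \<le> e}" "m \<in> keys (dpart i t p)"
  then have "m + single i t \<in> mons n" "mdeg (m + single i t) \<le> e"
    using keys_dpart by blast+
  then show "m \<in> mons n" "mdeg m \<le> e"
    by (auto simp: mons_iff lookup_add mdeg_add)
qed

lemma polys_dpart: "p \<in> polys n \<Longrightarrow> dpart i t p \<in> polys n"
  unfolding polys_ex_bpolys using bpolys_dpart by blast

section \<open>Divided derivatives on the fraction field\<close>

lemma dpart_dpart:
  "dpart i a (dpart i r g) = of_nat ((a + r) choose r) * dpart i (a + r) g"
proof (rule poly_mapping_eqI)
  fix m
  have "((lookup m i + a) choose a) * ((lookup m i + a + r) choose r) =
        ((a + r) choose r) * ((lookup m i + (a + r)) choose (a + r))"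
    using choose_mult [of r "a + r" "lookup m i + (a + r)"]
    by (simp add: algebra_simps)
  then have "of_nat ((lookup m i + a) choose a) * of_nat ((lookup m i + a + r) choose r) =
        (of_nat ((a + r) choose r) * of_nat ((lookup m i + (a + r)) choose (a + r)) :: 'a)"
    by (metis of_nat_mult)
  moreover have "lookup (of_nat k * p) m = of_nat k * lookup p m" for k :: nat and p :: "'a mpoly"
    by (induction k) (simp_all add: lookup_add algebra_simps)
  ultimately show "lookup (dpart i a (dpart i r g)) m =
      lookup (of_nat ((a + r) choose r) * dpart i (a + r) g) m"
    by (simp add: lookup_dpart lookup_add single_add add.assoc flip: mult.assoc)
qed

lemma dpart_eq_0:
  assumes "g \<in> polys i" "t > 0"
  shows "dpart i t g = 0"
proof (rule poly_mapping_eqI)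
  fix m
  have "m + single i t \<notin> mons i"
    using assms by (auto simp: mons_iff lookup_add)
  then have "m + single i t \<notin> keys g"
    using assms by (auto simp: polys_iff)
  then show "lookup (dpart i t g) m = lookup 0 m"
    by (simp add: lookup_dpart in_keys_iff)
qed

definition emb :: "'k::field mpoly \<Rightarrow> 'k mpoly fract" where
  "emb g = Fract g 1"

lemma emb_add: "emb (g + h) = emb g + emb h"
  and emb_mult: "emb (g * h) = emb g * emb h"
  and emb_uminus: "emb (- g) = - emb g"
  and emb_diff: "emb (g - h) = emb g - emb h"
  and emb_zero [simp]: "emb 0 = 0"
  and emb_one [simp]: "emb 1 = 1"
  and emb_eq_iff: "emb g = emb h \<longleftrightarrow> g = h"
  by (simp_all add: emb_def eq_fract Zero_fract_def One_fract_def)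

lemma emb_eq_0_iff [simp]: "emb g = 0 \<longleftrightarrow> g = 0"
  using emb_eq_iff [of g 0] by simp

lemma emb_power: "emb (g ^ t) = emb g ^ t"
  by (induction t) (simp_all add: emb_mult)

lemma emb_sum: "emb (sum g S) = (\<Sum>x\<in>S. emb (g x))"
  by (induction S rule: infinite_finite_induct) (simp_all add: emb_add)

lemma emb_of_nat: "emb (of_nat k) = of_nat k"
  by (induction k) (simp_all add: emb_add)

lemma Fract_emb: "F \<noteq> 0 \<Longrightarrow> Fract g F = emb g / emb F"
  by (simp add: emb_def eq_fract)

text \<open>The Taylor expansion of \<open>h\<close> in the variable \<open>x\<^sub>i\<close>, i.e. \<open>h(x\<^sub>i + T)\<close>, is a ring homomorphism
  into power series in \<open>T\<close>; hence it extends to the fraction field, and its coefficients are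
  the divided derivatives there.\<close>
definition taylor_poly :: "nat \<Rightarrow> 'k::field mpoly \<Rightarrow> 'k mpoly fract fps" where
  "taylor_poly i g = Abs_fps (\<lambda>t. emb (dpart i t g))"

lemma taylor_poly_nth [simp]: "fps_nth (taylor_poly i g) t = emb (dpart i t g)"
  by (simp add: taylor_poly_def)

lemma taylor_poly_add: "taylor_poly i (g + h) = taylor_poly i g + taylor_poly i h"
  by (rule fps_ext) (simp add: dpart_add emb_add)

lemma taylor_poly_mult: "taylor_poly i (g * h) = taylor_poly i g * taylor_poly i h"
  by (rule fps_ext)
    (simp add: fps_mult_nth dpart_mult emb_sum emb_mult atLeast0AtMost)

lemma taylor_poly_nonzero: "g \<noteq> 0 \<Longrightarrow> taylor_poly i g \<noteq> 0"
  by (metis dpart_order_zero emb_eq_0_iff fps_zero_nth taylor_poly_nth)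

definition taylor :: "nat \<Rightarrow> 'k::field mpoly fract \<Rightarrow> 'k mpoly fract fps" where
  "taylor i h = (SOME X. \<exists>g F. F \<noteq> 0 \<and> h = Fract g F \<and> X * taylor_poly i F = taylor_poly i g)"

text \<open>Series obtained from two fractions for the same element agree after multiplication by
  the nonzero series of both denominators. Power series over a field have no zero divisors, so the
  choice in \<open>taylor\<close> is unique.\<close>

lemma taylor_eqI:
  assumes "F \<noteq> 0" "X * taylor_poly i F = taylor_poly i g"
  shows "taylor i (Fract g F) = X"
  unfolding taylor_def
proof (rule some_equality)
  show "\<exists>g' F'. F' \<noteq> 0 \<and> Fract g F = Fract g' F' \<and> X * taylor_poly i F' = taylor_poly i g'"
    using assms by blast
next
  fix Y
  assume "\<exists>g' F'. F' \<noteq> 0 \<and> Fract g F = Fract g' F' \<and> Y * taylor_poly i F' = taylor_poly i g'"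
  then obtain g' F' where gF: "F' \<noteq> 0" "g * F' = g' * F" "Y * taylor_poly i F' = taylor_poly i g'"
    using assms(1) by (auto simp: eq_fract)
  have "X * (taylor_poly i F * taylor_poly i F') = taylor_poly i (g * F')"
    using assms(2) by (simp add: taylor_poly_mult flip: mult.assoc)
  also have "\<dots> = Y * (taylor_poly i F * taylor_poly i F')"
    using gF by (simp add: taylor_poly_mult mult_ac flip: gF(3))
  finally show "Y = X"
    using taylor_poly_nonzero [OF assms(1), of i] taylor_poly_nonzero [OF gF(1), of i] by simp
qed

text \<open>The series of the denominator has the nonzero constant term \<open>emb F\<close> and is
  therefore invertible.\<close>

lemma taylor_Fract:
  assumes "F \<noteq> 0"
  shows "taylor i (Fract g F) * taylor_poly i F = taylor_poly i g"
proof -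
  have "inverse (taylor_poly i F) * taylor_poly i F = 1"
    using assms by (intro inverse_mult_eq_1) simp
  then have "(taylor_poly i g * inverse (taylor_poly i F)) * taylor_poly i F = taylor_poly i g"
    by (simp add: mult.assoc)
  then show ?thesis
    using taylor_eqI [OF assms] by metis
qed

lemma taylor_add: "taylor i (h + h') = taylor i h + taylor i h'"
proof (cases h, cases h')
  fix g F g' F'
  assume *: "h = Fract g F" "F \<noteq> 0" "h' = Fract g' F'" "F' \<noteq> 0"
  have "(taylor i h + taylor i h') * taylor_poly i (F * F') =
      (taylor i h * taylor_poly i F) * taylor_poly i F' +
      (taylor i h' * taylor_poly i F') * taylor_poly i F"
    by (simp add: taylor_poly_mult algebra_simps)
  also have "\<dots> = taylor_poly i (g * F' + g' * F)"
    using * by (simp add: taylor_Fract taylor_poly_mult taylor_poly_add)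
  finally show ?thesis
    using * by (simp add: taylor_eqI)
qed

lemma taylor_mult: "taylor i (h * h') = taylor i h * taylor i h'"
proof (cases h, cases h')
  fix g F g' F'
  assume *: "h = Fract g F" "F \<noteq> 0" "h' = Fract g' F'" "F' \<noteq> 0"
  have "(taylor i h * taylor i h') * taylor_poly i (F * F') =
      (taylor i h * taylor_poly i F) * (taylor i h' * taylor_poly i F')"
    by (simp add: taylor_poly_mult algebra_simps)
  also have "\<dots> = taylor_poly i (g * g')"
    using * by (simp add: taylor_Fract taylor_poly_mult)
  finally show ?thesis
    using * by (simp add: taylor_eqI)
qed

lemma dpart_one: "dpart i t 1 = (if t = 0 then 1 else 0)"
  by (simp add: dpart_eq_0)

lemma taylor_poly_one: "taylor_poly i 1 = 1"
  by (rule fps_ext) (simp add: dpart_one)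

lemma taylor_emb: "taylor i (emb g) = taylor_poly i g"
  unfolding emb_def by (rule taylor_eqI) (simp_all add: taylor_poly_one)

definition fder :: "nat \<Rightarrow> nat \<Rightarrow> 'k::field mpoly fract \<Rightarrow> 'k mpoly fract" where
  "fder i t h = fps_nth (taylor i h) t"

lemma fder_add: "fder i t (h + h') = fder i t h + fder i t h'"
  by (simp add: fder_def taylor_add)

lemma fder_emb: "fder i t (emb g) = emb (dpart i t g)"
  by (simp add: fder_def taylor_emb)

lemma fder_zero [simp]: "fder i t 0 = 0"
  using fder_emb [of i t 0] by simp

lemma fder_uminus: "fder i t (- h) = - fder i t h"
  using fder_add [of i t h "- h"] by (simp add: eq_neg_iff_add_eq_0 add.commute)

lemma fder_mult: "fder i t (h * h') = (\<Sum>a\<le>t. fder i a h * fder i (t - a) h')"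
  by (simp add: fder_def taylor_mult fps_mult_nth atLeast0AtMost)

lemma fder_order_zero [simp]: "fder i 0 h = h"
proof (cases h)
  case (Fract g F)
  then have "fder i 0 h * emb F = emb g"
    using arg_cong [OF taylor_Fract [of F i g], of "\<lambda>X. fps_nth X 0"]
    by (simp add: fder_def)
  moreover have "h * emb F = emb g"
    using Fract by (simp add: Fract_emb)
  ultimately have "fder i 0 h * emb F = h * emb F"
    by simp
  with Fract show ?thesis
    by simp
qed

lemma fder_mult_const:
  assumes "g \<in> polys i"
  shows "fder i t (emb g * h) = emb g * fder i t h"
proof -
  have "fder i t (emb g * h) = (\<Sum>a\<le>t. if a = 0 then emb g * fder i t h else 0)"
    unfolding fder_mult
    by (rule sum.cong) (auto simp: fder_emb dpart_eq_0 [OF assms])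
  then show ?thesis
    by simp
qed

text \<open>Expanding the right side by Leibniz and collecting the terms with derivative of order
  \<open>k\<close> on \<open>g\<close> leaves the alternating sum of the binomials
  \<open>k choose r\<close>, which is 0 unless \<open>k = 0\<close>. This moves a factor
  \<open>g\<close> inside a derivative at the cost of lower orders.\<close>

lemma emb_mult_fder:
  "emb g * fder i t h = (\<Sum>r\<le>t. (-1) ^ r * fder i (t - r) (emb (dpart i r g) * h))"
proof -
  let ?f = "\<lambda>r a. (-1) ^ r * of_nat ((a + r) choose r) * emb (dpart i (a + r) g)
      * fder i (t - (a + r)) h"
  have "(\<Sum>r\<le>t. (-1) ^ r * fder i (t - r) (emb (dpart i r g) * h)) =
      (\<Sum>r\<le>t. \<Sum>a\<le>t - r. ?f r a)"
    by (intro sum.cong refl)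
      (simp add: fder_mult fder_emb dpart_dpart emb_mult emb_of_nat sum_distrib_left mult.assoc add.commute)
  also have "\<dots> = sum (\<lambda>(r, a). ?f r a) {(r, a). r + a \<le> t}"
    by (subst sum.Sigma) (auto intro!: sum.cong)
  also have "\<dots> = (\<Sum>k\<le>t. \<Sum>r\<le>k. ?f r (k - r))"
    by (rule sum.triangle_reindex_eq)
  also have "\<dots> = (\<Sum>k\<le>t. (\<Sum>r\<le>k. (-1) ^ r * of_nat (k choose r)) * emb (dpart i k g)
      * fder i (t - k) h)"
    by (simp add: sum_distrib_right)
  also have "\<dots> = (\<Sum>k\<le>t. if k = 0 then emb g * fder i t h else 0)"
    by (intro sum.cong refl) (auto simp: choose_alternating_sum)
  finally show ?thesis
    by simp
qed

section \<open>Representatives as elements of the fraction field\<close>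

definition phi :: "'k::field mpoly \<Rightarrow> 'k mpoly \<times> nat \<Rightarrow> 'k mpoly fract" where
  "phi f p = Fract (fst p) (f ^ snd p)"

lemma phi_alt: "f \<noteq> 0 \<Longrightarrow> phi f p = emb (fst p) / emb f ^ snd p"
  by (simp add: phi_def Fract_emb emb_power)

lemma loc_eq_iff_phi: "f \<noteq> 0 \<Longrightarrow> loc_eq f p q \<longleftrightarrow> phi f p = phi f q"
  by (auto simp: loc_eq_def phi_def eq_fract)

lemma phi_loc_add: "f \<noteq> 0 \<Longrightarrow> phi f (loc_add f p q) = phi f p + phi f q"
  by (simp add: phi_alt loc_add_def emb_add emb_mult emb_power power_add field_simps)

declare dloc_num.simps [simp del]

text \<open>With \<open>h = g / F\<close>, the recursion for \<open>dloc_num\<close> is the Leibniz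
  rule for \<open>g = F * h\<close>, solved for the term with the highest derivative of
  \<open>h\<close> and multiplied by \<open>F ^ t\<close> to clear denominators.\<close>

lemma emb_dloc_num:
  assumes "F \<noteq> 0"
  shows "emb (dloc_num i F g t) = emb F ^ (t + 1) * fder i t (Fract g F)"
proof (induction t rule: less_induct)
  case (less t)
  let ?h = "Fract g F"
  have "emb g = ?h * emb F"
    using assms by (simp add: Fract_emb)
  then have "emb (dpart i t g) = (\<Sum>a\<le>t. emb (dpart i a F) * fder i (t - a) ?h)"
    using fder_mult [of i t "emb F" ?h] by (metis (no_types, lifting) fder_emb mult.commute sum.cong)
  also have "\<dots> = emb F * fder i t ?h + (\<Sum>j=1..t. emb (dpart i j F) * fder i (t - j) ?h)"
    by (simp add: atMost_atLeast0 sum.atLeast_Suc_atMost)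
  finally have "emb F ^ t * emb (dpart i t g) = emb F ^ (t + 1) * fder i t ?h +
      (\<Sum>j=1..t. emb F ^ t * (emb (dpart i j F) * fder i (t - j) ?h))"
    by (simp add: algebra_simps sum_distrib_left)
  moreover have "(\<Sum>j=1..t. emb F ^ t * (emb (dpart i j F) * fder i (t - j) ?h)) =
     (\<Sum>j=1..t. emb (dpart i j F) * emb F ^ (j - 1) * emb (dloc_num i F g (t - j)))"
  proof (intro sum.cong refl)
    fix j assume j: "j \<in> {1..t}"
    then have "t = (j - 1) + (t - j + 1)"
      by auto
    then have "emb F ^ t = emb F ^ (j - 1) * emb F ^ (t - j + 1)"
      by (metis power_add)
    then show "emb F ^ t * (emb (dpart i j F) * fder i (t - j) ?h) =
        emb (dpart i j F) * emb F ^ (j - 1) * emb (dloc_num i F g (t - j))"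
      using j less [of "t - j"] by (simp add: algebra_simps)
  qed
  ultimately show ?case
    by (subst dloc_num.simps) (simp add: emb_diff emb_mult emb_power emb_sum)
qed

lemma phi_dact:
  assumes "f \<noteq> 0"
  shows "phi f (dact f i t p) = fder i t (phi f p)"
proof -
  have "emb (f ^ snd p) ^ (t + 1) = emb f ^ (snd p * (t + 1))"
    by (simp only: emb_power power_mult)
  then have "phi f (dact f i t p) = fder i t (Fract (fst p) (f ^ snd p))"
    using assms emb_dloc_num [of "f ^ snd p" i "fst p" t]
    by (simp only: phi_alt [OF assms] dact_def fst_conv snd_conv) simp
  then show ?thesis
    by (simp add: phi_def)
qed

section \<open>Noetherianity and D-submodules\<close>

text \<open>A monotone subsequence that is not increasing is nonincreasing, hence constant from the
  point on where its minimum is attained.\<close>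

lemma nat_seq_mono_subseq:
  fixes a :: "nat \<Rightarrow> nat"
  shows "\<exists>r :: nat \<Rightarrow> nat. strict_mono r \<and> mono (\<lambda>k. a (r k))"
proof -
  obtain f where f: "strict_mono f" "monoseq (\<lambda>k. a (f k))"
    using seq_monosub by blast
  show ?thesis
  proof (cases "mono (\<lambda>k. a (f k))")
    case True
    with f show ?thesis by blast
  next
    case False
    then have dec: "a (f l) \<le> a (f k)" if "k \<le> l" for k l
      using f(2) that unfolding monoseq_def mono_def by blast
    obtain k0 where k0: "\<And>k. a (f k0) \<le> a (f k)"
      using ex_has_least_nat [of "\<lambda>_. True" 0 "\<lambda>k. a (f k)"] by auto
    have "a (f (k0 + k)) = a (f k0)" for k
      using dec [of k0 "k0 + k"] k0 [of "k0 + k"] by simp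
    then have "mono (\<lambda>k. a (f (k0 + k)))"
      by (simp add: mono_def)
    moreover have "strict_mono (\<lambda>k. f (k0 + k))"
      using f(1) by (simp add: strict_mono_def)
    ultimately show ?thesis by blast
  qed
qed

text \<open>Dickson's lemma in sequence form: a subsequence is extracted for one coordinate after
  another.\<close>

lemma dickson:
  fixes a :: "nat \<Rightarrow> nat \<Rightarrow> nat"
  shows "\<exists>r :: nat \<Rightarrow> nat. strict_mono r \<and> (\<forall>i<n. mono (\<lambda>k. a (r k) i))"
proof (induction n)
  case 0
  show ?case by (rule exI [of _ id]) (simp add: strict_mono_def)
next
  case (Suc n)
  then obtain r :: "nat \<Rightarrow> nat" where r: "strict_mono r" "\<And>i. i < n \<Longrightarrow> mono (\<lambda>k. a (r k) i)"
    by blast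
  obtain r' :: "nat \<Rightarrow> nat" where r': "strict_mono r'" "mono (\<lambda>k. a (r (r' k)) n)"
    using nat_seq_mono_subseq [of "\<lambda>k. a (r k) n"] by blast
  have "mono (\<lambda>k. a (r (r' k)) i)" if "i < Suc n" for i
    using that r(2) [of i] r' strict_mono_mono [OF r'(1)]
    by (cases "i = n") (auto simp: mono_def)
  moreover have "strict_mono (\<lambda>k. r (r' k))"
    using r(1) r'(1) by (simp add: strict_mono_def)
  ultimately show ?case by blast
qed

lemma dickson_mons:
  fixes a :: "nat \<Rightarrow> nat \<Rightarrow>\<^sub>0 nat"
  assumes "\<And>k. a k \<in> mons n"
  obtains i j :: nat and c where "i < j" "c \<in> mons n" "a j = c + a i"
proof -
  obtain r :: "nat \<Rightarrow> nat" where r: "strict_mono r" "\<And>i. i < n \<Longrightarrow> mono (\<lambda>k. lookup (a (r k)) i)"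
    using dickson [of n "\<lambda>k. lookup (a k)"] by blast
  have le: "lookup (a (r 0)) i \<le> lookup (a (r 1)) i" for i
    using r(2) [of i] assms by (cases "i < n") (auto simp: mono_def mons_iff)
  show thesis
  proof
    show "r 0 < r 1"
      using r(1) by (simp add: strict_mono_def)
    show "a (r 1) - a (r 0) \<in> mons n"
      using assms by (simp add: mons_iff lookup_minus)
    show "a (r 1) = a (r 1) - a (r 0) + a (r 0)"
      using le by (intro poly_mapping_eqI) (simp add: lookup_add lookup_minus)
  qed
qed

section \<open>The lexicographic monomial order and the ascending chain condition\<close>

lemma monomial_nonneg: "(0 :: nat \<Rightarrow>\<^sub>0 nat) \<le> c"
proof (cases "c = 0")
  case False
  then have "\<exists>k. lookup c k \<noteq> 0"
    by (metis lookup_zero poly_mapping_eqI)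
  then obtain k where "lookup c k \<noteq> 0" "\<And>k'. k' < k \<Longrightarrow> lookup c k' = 0"
    using exists_least_iff [of "\<lambda>k. lookup c k \<noteq> 0"] by blast
  then have "0 < c"
    by (auto simp: less_poly_mapping.rep_eq less_fun_def intro!: exI [of _ k])
  then show ?thesis by simp
qed simp

text \<open>With infinitely many variables the lexicographic order has infinite descending chains,
  hence the restriction to \<open>mons n\<close>. There Dickson's lemma yields \<open>i < j\<close>
  with \<open>a i\<close> dividing \<open>a j\<close>, so \<open>a i \<le> a j\<close>, against
  strict descent.\<close>

lemma wf_mons: "wf {(a, b). a \<in> mons n \<and> b \<in> mons n \<and> a < b}"
  unfolding wf_iff_no_infinite_down_chain
proof
  assume "\<exists>a. \<forall>k. (a (Suc k), a k) \<in> {(a, b). a \<in> mons n \<and> b \<in> mons n \<and> a < b}"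
  then obtain a where a: "\<And>k. a k \<in> mons n" "\<And>k. a (Suc k) < a k"
    by blast
  obtain i j c where ij: "i < j" "a j = c + a i"
    by (rule dickson_mons [of a n]) (use a(1) in blast)+
  have "a (i + Suc k) < a i" for k
    by (induction k) (use a(2) in \<open>auto intro: less_trans\<close>)
  from this [of "j - Suc i"] have "a j < a i"
    using ij(1) by simp
  moreover have "a i \<le> a j"
    using add_right_mono [OF monomial_nonneg [of c], of "a i"] ij by simp
  ultimately show False by simp
qed

lemma lookup_single_mult: "lookup (single c x * p) (c + m) = x * lookup p m"
  for p :: "'k::field mpoly"
proof (induction p rule: mpoly_induct)
  case (single m' y)
  then show ?case by (simp add: mult_single lookup_single when_def)
next
  case (add p q)
  then show ?case by (simp add: distrib_left lookup_add)
qed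

text \<open>Choose \<open>h k\<close> in \<open>I (Suc k) - I k\<close> with minimal leading
  monomial. By Dickson's lemma the leading monomial of some \<open>h i\<close> divides that of a
  later \<open>h j\<close>; cancelling the leading term of \<open>h j\<close> by a multiple of
  \<open>h i\<close> contradicts minimality.\<close>

lemma polys_noetherian:
  fixes I :: "nat \<Rightarrow> 'k::field mpoly set"
  assumes sub: "\<And>k. I k \<subseteq> polys n"
    and zero: "\<And>k. 0 \<in> I k"
    and diff: "\<And>k p q. p \<in> I k \<Longrightarrow> q \<in> I k \<Longrightarrow> p - q \<in> I k"
    and mult: "\<And>k a p. a \<in> polys n \<Longrightarrow> p \<in> I k \<Longrightarrow> a * p \<in> I k"
    and strict: "\<And>k. I k \<subset> I (Suc k)"
  shows False
proof -
  let ?lm = "\<lambda>p :: 'k mpoly. Max (keys p)"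
  have lm_mons: "?lm p \<in> mons n" if "p \<in> polys n" "p \<noteq> 0" for p
    using that Max_in [of "keys p"] by (auto simp: polys_iff)
  have "\<exists>h. h \<in> I (Suc k) - I k \<and> (\<forall>h'\<in>I (Suc k) - I k. \<not> ?lm h' < ?lm h)" for k
  proof -
    have ne: "h \<noteq> 0" "h \<in> polys n" if "h \<in> I (Suc k) - I k" for h
      using that zero sub by auto
    obtain h0 where "h0 \<in> I (Suc k) - I k"
      using strict [of k] by blast
    then obtain h where h: "h \<in> I (Suc k) - I k"
      "\<And>h'. (h', h) \<in> inv_image {(a, b). a \<in> mons n \<and> b \<in> mons n \<and> a < b} ?lm
         \<Longrightarrow> h' \<notin> I (Suc k) - I k"
      by (rule wfE_min [OF wf_inv_image [OF wf_mons [of n], of ?lm]]) blast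
    have "\<not> ?lm h' < ?lm h" if "h' \<in> I (Suc k) - I k" for h'
      using h(2) [of h'] that lm_mons [OF ne(2,1) [OF that]] lm_mons [OF ne(2,1) [OF h(1)]]
      unfolding in_inv_image by blast
    with h(1) show ?thesis
      by blast
  qed
  then have "\<exists>h. \<forall>k. h k \<in> I (Suc k) - I k \<and> (\<forall>h'\<in>I (Suc k) - I k. \<not> ?lm h' < ?lm (h k))"
    by (intro choice allI)
  then obtain h where h: "\<And>k. h k \<in> I (Suc k) - I k"
      and hmin: "\<And>k h'. h' \<in> I (Suc k) - I k \<Longrightarrow> \<not> ?lm h' < ?lm (h k)"
    by blast
  have ne: "h k \<noteq> 0" "h k \<in> polys n" for k
    using h [of k] zero [of k] sub [of "Suc k"] by auto
  obtain i j c where ij: "i < j" "c \<in> mons n" "?lm (h j) = c + ?lm (h i)"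
    by (rule dickson_mons [of "\<lambda>k. ?lm (h k)" n, OF lm_mons [OF ne(2) ne(1)]])
  have mono: "I k \<subseteq> I l" if "k \<le> l" for k l
    by (rule lift_Suc_mono_le [of I, OF psubset_imp_subset [OF strict] that])
  \<comment> \<open>The ratio of the leading coefficients: \<open>q\<close> gets the same leading
    term as \<open>h j\<close>, and it lies in \<open>I j\<close> because
    \<open>i < j\<close>.\<close>
  define x where "x = lookup (h j) (?lm (h j)) / lookup (h i) (?lm (h i))"
  define q where "q = single c x * h i"
  have lmk: "?lm (h k) \<in> keys (h k)" for k
    using ne(1) [of k] by (intro Max_in) auto
  have q_in: "q \<in> I j"
    unfolding q_def using h [of i] ij mono [of "Suc i" j]
    by (intro mult polys_single) auto
  have "h j - q \<in> I (Suc j)"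
    using h [of j] q_in mono [of j "Suc j"] by (intro diff) auto
  moreover have "h j - q \<notin> I j"
  proof
    assume "h j - q \<in> I j"
    moreover have "- q \<in> I j"
      using diff [OF zero q_in] by simp
    ultimately have "(h j - q) - - q \<in> I j"
      by (rule diff)
    then show False
      using h [of j] by simp
  qed
  ultimately have h': "h j - q \<in> I (Suc j) - I j"
    by blast
  have keysq: "m \<le> ?lm (h j)" if m: "m \<in> keys q" for m
  proof -
    obtain m' where "m' \<in> keys (h i)" "m = c + m'"
      using m keys_mult [of "single c x" "h i"] unfolding q_def by (auto split: if_splits)
    then show ?thesis
      unfolding ij(3) by (simp only:) (intro add_left_mono Max_ge finite_keys)
  qed
  have "lookup (h j - q) (?lm (h j)) = 0"
    unfolding lookup_minus q_def ij(3) lookup_single_mult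
    using lmk [of i] ij(3) by (simp add: x_def in_keys_iff)
  then have "m < ?lm (h j)" if m: "m \<in> keys (h j - q)" for m
  proof -
    have "m \<noteq> ?lm (h j)"
      using m \<open>lookup (h j - q) (?lm (h j)) = 0\<close> by (metis in_keys_iff)
    moreover have "m \<le> ?lm (h j)"
      using m keys_diff [of "h j" q] keysq [of m] Max_ge [OF finite_keys, of m "h j"] by blast
    ultimately show ?thesis
      by (rule le_neq_trans [rotated])
  qed
  moreover have "?lm (h j - q) \<in> keys (h j - q)"
    using h' zero by (intro Max_in) auto
  ultimately show False
    using hmin [OF h'] by blast
qed

section \<open>D-submodules of the fraction field and annihilators modulo them\<close>

definition dsub :: "nat \<Rightarrow> 'k::field mpoly fract set \<Rightarrow> bool" where
  "dsub n M \<longleftrightarrow> 0 \<in> M \<and> (\<forall>u\<in>M. \<forall>v\<in>M. u + v \<in> M) \<and>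
     (\<forall>a\<in>polys n. \<forall>v\<in>M. emb a * v \<in> M) \<and> (\<forall>i<n. \<forall>t. \<forall>v\<in>M. fder i t v \<in> M)"

lemma dsubD:
  assumes "dsub n M"
  shows dsub_zero: "0 \<in> M"
    and dsub_add: "u \<in> M \<Longrightarrow> v \<in> M \<Longrightarrow> u + v \<in> M"
    and dsub_mult: "a \<in> polys n \<Longrightarrow> v \<in> M \<Longrightarrow> emb a * v \<in> M"
    and dsub_fder: "i < n \<Longrightarrow> v \<in> M \<Longrightarrow> fder i t v \<in> M"
  using assms unfolding dsub_def by blast+

lemma dsub_uminus: "dsub n M \<Longrightarrow> v \<in> M \<Longrightarrow> - v \<in> M"
  using dsub_mult [of n M "- 1" v] polys_uminus [of 1 n] by (simp add: emb_uminus)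

lemma dsub_diff: "dsub n M \<Longrightarrow> u \<in> M \<Longrightarrow> v \<in> M \<Longrightarrow> u - v \<in> M"
  using dsub_add [of n M u "- v"] dsub_uminus [of n M v] by simp

lemma dsub_diff_iff: "dsub n M \<Longrightarrow> u - v \<in> M \<Longrightarrow> u \<in> M \<longleftrightarrow> v \<in> M"
  using dsub_add [of n M "u - v" v] dsub_diff [of n M u "u - v"] by auto

lemma dsub_sum: "dsub n M \<Longrightarrow> (\<And>x. x \<in> S \<Longrightarrow> g x \<in> M) \<Longrightarrow> sum g S \<in> M"
  by (induction S rule: infinite_finite_induct) (auto intro: dsub_add dsub_zero)

definition ann :: "nat \<Rightarrow> 'k::field mpoly fract set \<Rightarrow> 'k mpoly fract \<Rightarrow> 'k mpoly set" where
  "ann n A w = {h \<in> polys n. emb h * w \<in> A}"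

text \<open>Annihilators modulo \<open>A\<close> are ideals, so by the ascending chain condition
  they cannot grow strictly forever.\<close>

lemma ann_maximal:
  assumes A: "dsub n A" and ne: "B - A \<noteq> {}"
  obtains w where "w \<in> B - A" "\<And>v. v \<in> B - A \<Longrightarrow> ann n A w \<subseteq> ann n A v \<Longrightarrow> ann n A v = ann n A w"
proof -
  have "wf {(v, w). ann n A w \<subset> ann n A v}"
    unfolding wf_iff_no_infinite_down_chain
  proof
    assume "\<exists>f. \<forall>k. (f (Suc k), f k) \<in> {(v, w). ann n A w \<subset> ann n A v}"
    then obtain f where f: "\<And>k. ann n A (f k) \<subset> ann n A (f (Suc k))"
      by blast
    show False
    proof (rule polys_noetherian [of "\<lambda>k. ann n A (f k)" n])
      fix k p q assume "p \<in> ann n A (f k)" "q \<in> ann n A (f k)"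
      then show "p - q \<in> ann n A (f k)"
        using dsub_diff [OF A] by (auto simp: ann_def emb_diff algebra_simps intro: polys_diff)
    next
      fix k and a p :: "'a mpoly" assume "a \<in> polys n" "p \<in> ann n A (f k)"
      then show "a * p \<in> ann n A (f k)"
        using dsub_mult [OF A] by (auto simp: ann_def emb_mult mult.assoc intro: polys_mult)
    qed (use f dsub_zero [OF A] in \<open>auto simp: ann_def\<close>)
  qed
  moreover obtain w0 where "w0 \<in> B - A"
    using ne by blast
  ultimately obtain w where "w \<in> B - A"
    "\<And>v. (v, w) \<in> {(v, w). ann n A w \<subset> ann n A v} \<Longrightarrow> v \<notin> B - A"
    by (rule wfE_min) blast
  then show thesis
    by (intro that [of w]) auto
qed

section \<open>Independent families modulo a D-submodule\<close>

text \<open>\<open>fold\<close> applies the head of the list first, so for \<open>[i..<n]\<close>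
  the derivative in \<open>x_i\<close> is innermost, next to the element that
  \<open>fder_strip\<close> works on.\<close>

abbreviation iter_fder :: "nat list \<Rightarrow> (nat \<Rightarrow> nat) \<Rightarrow> 'k::field mpoly fract \<Rightarrow> 'k mpoly fract" where
  "iter_fder js e \<equiv> fold (\<lambda>j. fder j (e j)) js"

lemma iter_fder_add: "iter_fder js e (u + v) = iter_fder js e u + iter_fder js e v"
  by (induction js arbitrary: u v) (simp_all add: fder_add)

lemma iter_fder_zero [simp]: "iter_fder js e 0 = 0"
  by (induction js) simp_all

lemma iter_fder_uminus: "iter_fder js e (- v) = - iter_fder js e v"
  by (induction js arbitrary: v) (simp_all add: fder_uminus)

lemma iter_fder_diff: "iter_fder js e (u - v) = iter_fder js e u - iter_fder js e v"
  using iter_fder_add [of e js u "- v"] by (simp add: iter_fder_uminus)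

lemma iter_fder_sum: "iter_fder js e (sum g S) = (\<Sum>x\<in>S. iter_fder js e (g x))"
  by (induction S rule: infinite_finite_induct) (simp_all add: iter_fder_add)

lemma iter_fder_mult_const:
  "(\<And>j. j \<in> set js \<Longrightarrow> g \<in> polys j) \<Longrightarrow> iter_fder js e (emb g * v) = emb g * iter_fder js e v"
  by (induction js arbitrary: v) (simp_all add: fder_mult_const)

lemma iter_fder_dsub: "dsub n M \<Longrightarrow> set js \<subseteq> {..<n} \<Longrightarrow> v \<in> M \<Longrightarrow> iter_fder js e v \<in> M"
  by (induction js arbitrary: v) (auto intro: dsub_fder)

lemma sum_in_dsub_cong:
  assumes "dsub n M" "\<And>x. x \<in> S \<Longrightarrow> g x - h x \<in> M"
  shows "sum g S \<in> M \<longleftrightarrow> sum h S \<in> M"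
  using assms dsub_diff_iff [of n M "sum g S" "sum h S"] dsub_sum [of n M S "\<lambda>x. g x - h x"]
  by (simp add: sum_subtractf)

text \<open>Every multiple of \<open>w\<close> outside \<open>A\<close> has the same annihilator
  modulo \<open>A\<close> as \<open>w\<close>. This makes \<open>P\<close> below an associated prime
  of the quotient by \<open>A\<close>.\<close>

locale assoc_element =
  fixes n :: nat and A :: "'k::field mpoly fract set" and w :: "'k mpoly fract"
  assumes A: "dsub n A" and w: "w \<notin> A"
    and maximal: "\<And>g. g \<in> polys n \<Longrightarrow> emb g * w \<notin> A \<Longrightarrow> ann n A (emb g * w) = ann n A w"
begin

abbreviation "P \<equiv> ann n A w"

lemma P_polys: "h \<in> P \<Longrightarrow> h \<in> polys n"
  by (simp add: ann_def)

lemma P_mult: "g \<in> polys n \<Longrightarrow> h \<in> P \<Longrightarrow> g * h \<in> P"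
  using dsub_mult [OF A] by (auto simp: ann_def emb_mult mult.assoc intro: polys_mult)

lemma one_notin_P: "1 \<notin> P"
  using w by (simp add: ann_def)

lemma P_prime:
  assumes "g \<in> polys n" "h \<in> polys n" "g * h \<in> P" "g \<notin> P"
  shows "h \<in> P"
proof (rule ccontr)
  assume "h \<notin> P"
  then have "ann n A (emb h * w) = P"
    using assms(2) by (intro maximal) (auto simp: ann_def)
  moreover have "g \<in> ann n A (emb h * w)"
    using assms by (simp add: ann_def emb_mult mult.assoc)
  ultimately show False
    using assms(4) by simp
qed

text \<open>The alternative \<open>t = 0\<close> serves the variables with
  \<open>sexp i = 0\<close>, where the base of the power is the witness \<open>g\<close> itself and
  lies in \<open>P\<close>.\<close>

lemma P_prime_power:
  assumes "g \<in> polys n" "h \<in> polys n" "g ^ t * h \<in> P" "t = 0 \<or> g \<notin> P"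
  shows "h \<in> P"
  using assms
proof (induction t)
  case (Suc t)
  then show ?case
    using P_prime [of g "g ^ t * h"] by (auto simp: mult.assoc intro: polys_mult polys_power)
qed simp

text \<open>If \<open>x\<^sub>i\<close> is transcendental over the previous variables modulo \<open>P\<close>, no such \<open>r\<close> exists. The
  value \<open>0\<close> is then the right one for \<open>ind_family\<close>, because \<open>b div 0 = 0\<close> and \<open>b mod 0 = b\<close>.\<close>
definition sexp :: "nat \<Rightarrow> nat" where
  "sexp i = (if \<exists>r. \<exists>g\<in>P \<inter> polys (Suc i). dpart i r g \<notin> P
     then LEAST r. \<exists>g\<in>P \<inter> polys (Suc i). dpart i r g \<notin> P else 0)"

text \<open>An attained minimum cannot be 0, since the derivative of order 0 is \<open>g\<close>
  itself. So \<open>sexp i = 0\<close> means that every derivative in \<open>x_i\<close> maps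
  \<open>P \<inter> polys (Suc i)\<close> into \<open>P\<close>.\<close>

lemma sexp_least:
  assumes "g \<in> P" "g \<in> polys (Suc i)" "sexp i = 0 \<or> r < sexp i"
  shows "dpart i r g \<in> P"
proof (rule ccontr)
  assume r: "dpart i r g \<notin> P"
  then have ex: "\<exists>r. \<exists>g\<in>P \<inter> polys (Suc i). dpart i r g \<notin> P"
    using assms by blast
  then have eq: "sexp i = (LEAST r. \<exists>g\<in>P \<inter> polys (Suc i). dpart i r g \<notin> P)"
    unfolding sexp_def by (rule if_P)
  have "\<exists>g\<in>P \<inter> polys (Suc i). dpart i (sexp i) g \<notin> P"
    unfolding eq by (rule LeastI_ex [OF ex])
  then have "sexp i \<noteq> 0"
    by (metis IntD1 dpart_order_zero)
  moreover have "sexp i \<le> r"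
    unfolding eq by (rule Least_le) (use r assms in blast)
  ultimately show False
    using assms(3) by simp
qed

lemma sexp_witness:
  obtains g where "g \<in> P" "g \<in> polys (Suc i)" "\<And>r. r < sexp i \<Longrightarrow> dpart i r g \<in> P"
    "sexp i = 0 \<or> dpart i (sexp i) g \<notin> P"
proof (cases "\<exists>r. \<exists>g\<in>P \<inter> polys (Suc i). dpart i r g \<notin> P")
  case True
  then have eq: "sexp i = (LEAST r. \<exists>g\<in>P \<inter> polys (Suc i). dpart i r g \<notin> P)"
    unfolding sexp_def by (rule if_P)
  have "\<exists>g\<in>P \<inter> polys (Suc i). dpart i (sexp i) g \<notin> P"
    unfolding eq by (rule LeastI_ex [OF True])
  then show thesis
    using that sexp_least by blast
next
  case False
  then have "sexp i = 0"
    unfolding sexp_def by (rule if_not_P)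
  moreover have "0 \<in> P"
    using dsub_zero [OF A] by (simp add: ann_def)
  ultimately show thesis
    by (intro that [of 0]) auto
qed

text \<open>Induction on the number of variables. If \<open>e\<close> is the degree of
  \<open>h\<close> in its last variable, the derivative of order \<open>e\<close> extracts the
  leading coefficient in that variable. It stays in \<open>P\<close> by \<open>sexp_least\<close>
  and vanishes by induction, a contradiction. Without variables, a nonzero constant would put 1 into
  \<open>P\<close>.\<close>

lemma reduced_in_P_eq_0:
  assumes "m \<le> n" "h \<in> polys m" "h \<in> P"
    and "\<And>b i. b \<in> keys h \<Longrightarrow> i < m \<Longrightarrow> sexp i = 0 \<or> lookup b i < sexp i"
  shows "h = 0"
  using assms
proof (induction m arbitrary: h)
  case 0
  show ?case
  proof (rule ccontr)
    assume "h \<noteq> 0"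
    have "keys h \<subseteq> {0}"
      using 0 by (auto simp: polys_iff mons_def)
    define c where "c = lookup h 0"
    have h: "h = single 0 c"
      using \<open>keys h \<subseteq> {0}\<close> unfolding c_def
      by (intro poly_mapping_eqI) (auto simp: lookup_single when_def in_keys_iff subset_iff)
    then have "c \<noteq> 0"
      using \<open>h \<noteq> 0\<close> by auto
    then have "single 0 (inverse c) * h = 1"
      by (simp add: h mult_single)
    moreover have "single 0 (inverse c) * h \<in> P"
      using 0 by (intro P_mult polys_single) auto
    ultimately show False
      using one_notin_P by simp
  qed
next
  case (Suc m)
  show ?case
  proof (rule ccontr)
    assume "h \<noteq> 0"
    define e where "e = Max ((\<lambda>b. lookup b m) ` keys h)"
    have "e \<in> (\<lambda>b. lookup b m) ` keys h"
      unfolding e_def using \<open>h \<noteq> 0\<close> by (intro Max_in) auto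
    then obtain b0 where b0: "b0 \<in> keys h" "lookup b0 m = e"
      by blast
    have le: "lookup b m \<le> e" if "b \<in> keys h" for b
      unfolding e_def using that by (intro Max_ge) auto
    have key: "b + single m e \<in> keys h" "lookup b m = 0" if "b \<in> keys (dpart m e h)" for b
      using keys_dpart [OF that] le [OF keys_dpart [OF that]] by (auto simp: lookup_add)
    have "dpart m e h = 0"
    proof (rule Suc.IH)
      show "m \<le> n"
        using Suc.prems by simp
      show "dpart m e h \<in> P"
        using Suc.prems(4) [OF b0(1), of m] b0(2) by (intro sexp_least Suc.prems(2,3)) auto
      show "dpart m e h \<in> polys m"
        unfolding polys_iff
      proof
        fix b assume b: "b \<in> keys (dpart m e h)"
        have "b + single m e \<in> mons (Suc m)"
          using key(1) [OF b] Suc.prems(2) by (auto simp: polys_iff)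
        then show "b \<in> mons m"
          using key(2) [OF b] unfolding mons_iff lookup_add
          by (metis add_is_0 le_eq_less_or_eq Suc_le_eq)
      qed
    next
      fix b i assume b: "b \<in> keys (dpart m e h)" and i: "i < m"
      show "sexp i = 0 \<or> lookup b i < sexp i"
        using Suc.prems(4) [OF key(1) [OF b], of i] i by (auto simp: lookup_add)
    qed
    moreover have "b0 - single m e + single m e = b0"
      using b0 minus_single_eq_iff [of e b0 m] by (metis order_refl)
    then have "lookup (dpart m e h) (b0 - single m e) = lookup h b0"
      using b0 by (simp add: lookup_dpart lookup_minus)
    ultimately show False
      using b0 by (simp add: in_keys_iff)
  qed
qed

text \<open>Each factor \<open>g\<close> is moved inside by \<open>emb_mult_fder\<close>. Terms with
  \<open>r < s\<close> fall into \<open>A\<close>, the term \<open>r = s\<close> lowers the order by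
  exactly \<open>s\<close>, and terms with \<open>r > s\<close> lower it too far to survive the
  remaining factors. So modulo \<open>A\<close>, \<open>Q\<close> factors turn a derivative of order
  \<open>s * Q\<close> into a multiplication and kill those of lower order.\<close>

lemma fder_strip:
  assumes i: "i < n" and g: "g \<in> P" "\<And>r. r < s \<Longrightarrow> dpart i r g \<in> P"
    and "k \<in> polys n" "t \<le> s * Q"
  shows "emb (g ^ Q) * fder i t (emb k * w)
     - (if t = s * Q then emb ((-1) ^ (s * Q) * dpart i s g ^ Q * k) * w else 0) \<in> A"
  using assms(4,5)
proof (induction Q arbitrary: t k)
  case 0
  then show ?case
    using dsub_zero [OF A] by simp
next
  case (Suc Q)
  let ?c = "emb ((-1) ^ (s * Suc Q) * dpart i s g ^ Suc Q * k) * w"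
  let ?f = "\<lambda>r. emb (g ^ Q) * ((-1) ^ r * fder i (t - r) (emb (dpart i r g * k) * w))"
  let ?h = "\<lambda>r. if r = s \<and> t = s * Suc Q then ?c else 0"
  have gp: "g \<in> polys n"
    using g(1) by (rule P_polys)
  have sgn: "(-1) ^ r * v \<in> A" if "v \<in> A" for v and r :: nat
    using that dsub_uminus [OF A] by (cases "even r") auto
  have "?f r - ?h r \<in> A" if r: "r \<le> t" for r
  proof (cases "r < s")
    case True
    have "k * dpart i r g \<in> P"
      using Suc.prems(1) g(2) [OF True] by (rule P_mult)
    then have "emb (dpart i r g * k) * w \<in> A"
      by (simp add: ann_def mult.commute)
    then have "?f r \<in> A"
      by (intro dsub_mult [OF A polys_power [OF gp]] sgn dsub_fder [OF A i])
    then show ?thesis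
      using True by simp
  next
    case False
    have kp: "dpart i r g * k \<in> polys n"
      using gp Suc.prems by (intro polys_mult polys_dpart)
    have tr: "t - r \<le> s * Q"
      using False Suc.prems r by simp
    \<comment> \<open>As \<open>s \<le> r\<close> and \<open>t \<le> s * Suc Q\<close>, the extremal
      order is reached only if both bounds are attained.\<close>
    have eq: "t - r = s * Q \<longleftrightarrow> r = s \<and> t = s * Suc Q"
      using False Suc.prems r by auto
    have "(-1) ^ r * (emb (g ^ Q) * fder i (t - r) (emb (dpart i r g * k) * w)
       - (if t - r = s * Q then emb ((-1) ^ (s * Q) * dpart i s g ^ Q * (dpart i r g * k)) * w else 0)) \<in> A"
      by (rule sgn [OF Suc.IH [OF kp tr]])
    also have "(-1) ^ r * (emb (g ^ Q) * fder i (t - r) (emb (dpart i r g * k) * w)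
       - (if t - r = s * Q then emb ((-1) ^ (s * Q) * dpart i s g ^ Q * (dpart i r g * k)) * w else 0))
       = ?f r - ?h r"
      unfolding eq
      by (simp add: algebra_simps power_add emb_mult emb_power emb_uminus)
    finally show ?thesis .
  qed
  then have "(\<Sum>r\<le>t. ?f r - ?h r) \<in> A"
    by (intro dsub_sum [OF A]) auto
  moreover have "(\<Sum>r\<le>t. ?f r) = emb (g ^ Suc Q) * fder i t (emb k * w)"
    using emb_mult_fder [of g i t "emb k * w"]
    by (simp add: emb_mult mult.assoc mult.left_commute [of "emb g"] flip: sum_distrib_left)
  moreover have "(\<Sum>r\<le>t. ?h r) = (if t = s * Suc Q then ?c else 0)"
    by (cases "t = s * Suc Q") simp_all
  ultimately show ?case
    by (simp add: sum_subtractf)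
qed

text \<open>One variable is stripped per induction step. Terms with coefficient in \<open>P\<close>
  are dropped; multiplying by \<open>g ^ Q\<close>, with \<open>Q\<close> the largest remaining
  \<open>q i\<close>, keeps only the terms with \<open>q i = Q\<close> and removes their derivative
  in \<open>x_i\<close>. The survivors are still told apart by their later coordinates, so the
  induction hypothesis applies.\<close>

lemma coefficients_in_P:
  assumes "i \<le> n" "finite I"
    and "\<And>q q'. q \<in> I \<Longrightarrow> q' \<in> I \<Longrightarrow> (\<And>j. i \<le> j \<Longrightarrow> j < n \<Longrightarrow> q j = q' j) \<Longrightarrow> q = q'"
    and "\<And>q j. q \<in> I \<Longrightarrow> sexp j = 0 \<Longrightarrow> q j = 0"
    and "\<And>q. q \<in> I \<Longrightarrow> k q \<in> polys n"
    and "(\<Sum>q\<in>I. iter_fder [i..<n] (\<lambda>j. sexp j * q j) (emb (k q) * w)) \<in> A"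
    and "q \<in> I"
  shows "k q \<in> P"
  using assms
proof (induction i arbitrary: I k q rule: inc_induct)
  case base
  have "I = {q}"
    using base by force
  then show ?case
    using base by (simp add: ann_def)
next
  case (step i)
  let ?D = "\<lambda>q. iter_fder [Suc i..<n] (\<lambda>j. sexp j * q j)"
  show ?case
  proof (rule ccontr)
    assume nq: "k q \<notin> P"
    define J where "J = {q \<in> I. k q \<notin> P}"
    have J: "finite J" "J \<noteq> {}" "J \<subseteq> I"
      using step.prems nq by (auto simp: J_def)
    define Q where "Q = Max ((\<lambda>q. q i) ` J)"
    have le: "q i \<le> Q" if "q \<in> J" for q
      unfolding Q_def using that J by (intro Max_ge) auto
    have "Q \<in> (\<lambda>q. q i) ` J"
      unfolding Q_def using J by (intro Max_in) auto
    then obtain q1 where q1: "q1 \<in> J" "q1 i = Q"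
      by blast
    obtain g where g: "g \<in> P" "g \<in> polys (Suc i)" "\<And>r. r < sexp i \<Longrightarrow> dpart i r g \<in> P"
      "sexp i = 0 \<or> dpart i (sexp i) g \<notin> P"
      using sexp_witness by blast
    have gp: "g \<in> polys n"
      using g(1) by (rule P_polys)
    \<comment> \<open>What \<open>fder_strip\<close> leaves of \<open>k q\<close> when
      \<open>q i = Q\<close>.\<close>
    define k' where "k' = (\<lambda>q. (-1) ^ (sexp i * Q) * dpart i (sexp i) g ^ Q * k q)"
    have k': "k' q \<in> polys n" if "q \<in> I" for q
      unfolding k'_def using that step.prems gp
      by (intro polys_mult polys_power polys_uminus polys_dpart) auto
    have eqn: "iter_fder [i..<n] (\<lambda>j. sexp j * q j) v = ?D q (fder i (sexp i * q i) v)" for q v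
      using step.hyps by (simp add: upt_conv_Cons)
    have "(\<Sum>q\<in>J. iter_fder [i..<n] (\<lambda>j. sexp j * q j) (emb (k q) * w)) \<in> A"
    proof -
      have "(\<Sum>q\<in>I - J. iter_fder [i..<n] (\<lambda>j. sexp j * q j) (emb (k q) * w)) \<in> A"
        by (rule dsub_sum [OF A], rule iter_fder_dsub [OF A]) (auto simp: J_def ann_def)
      with step.prems(5) show ?thesis
        using sum.subset_diff [OF J(3) step.prems(1),
            of "\<lambda>q. iter_fder [i..<n] (\<lambda>j. sexp j * q j) (emb (k q) * w)"]
          dsub_diff [OF A] by (metis (no_types, lifting) add_diff_cancel_left')
    qed
    then have "emb (g ^ Q) * (\<Sum>q\<in>J. ?D q (fder i (sexp i * q i) (emb (k q) * w))) \<in> A"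
      unfolding eqn using gp by (intro dsub_mult [OF A] polys_power)
    \<comment> \<open>\<open>g\<close> involves only \<open>x_0, ..., x_i\<close>, so it commutes
      with the outer derivatives, which are in later variables.\<close>
    also have "emb (g ^ Q) * (\<Sum>q\<in>J. ?D q (fder i (sexp i * q i) (emb (k q) * w))) =
        (\<Sum>q\<in>J. ?D q (emb (g ^ Q) * fder i (sexp i * q i) (emb (k q) * w)))"
      unfolding sum_distrib_left
      by (intro sum.cong refl iter_fder_mult_const [symmetric] polys_power polys_mono [OF g(2)]) simp
    finally have "(\<Sum>q\<in>J. ?D q (emb (g ^ Q) * fder i (sexp i * q i) (emb (k q) * w))) \<in> A" .
    moreover have "?D q (emb (g ^ Q) * fder i (sexp i * q i) (emb (k q) * w)) -
        ?D q (if q i = Q then emb (k' q) * w else 0) \<in> A" if q: "q \<in> J" for q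
    proof -
      \<comment> \<open>If \<open>sexp i = 0\<close>, cancellation fails, but then
        \<open>q i\<close> and \<open>Q\<close> are both 0.\<close>
      have "sexp i * q i = sexp i * Q \<longleftrightarrow> q i = Q"
        using step.prems(3) [of q i] step.prems(3) [of q1 i] subsetD [OF J(3) q]
          subsetD [OF J(3) q1(1)] q1(2) by auto
      then have "emb (g ^ Q) * fder i (sexp i * q i) (emb (k q) * w)
          - (if q i = Q then emb (k' q) * w else 0) \<in> A"
        using fder_strip [of i g "sexp i" "k q" "sexp i * q i" Q] g step.hyps step.prems(4) J(3) q
          le [OF q] unfolding k'_def by auto
      then show ?thesis
        unfolding iter_fder_diff [symmetric]
        by (intro iter_fder_dsub [OF A]) auto
    qed
    ultimately have "(\<Sum>q\<in>J. ?D q (if q i = Q then emb (k' q) * w else 0)) \<in> A"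
      using sum_in_dsub_cong [OF A] by (metis (no_types, lifting))
    also have "(\<Sum>q\<in>J. ?D q (if q i = Q then emb (k' q) * w else 0)) =
        (\<Sum>q\<in>{q \<in> J. q i = Q}. ?D q (emb (k' q) * w))"
      using J(1) by (intro sum.mono_neutral_cong_right) auto
    finally have "k' q1 \<in> P"
    proof (rule step.IH [rotated -2])
      show "q1 \<in> {q \<in> J. q i = Q}"
        using q1 by simp
    next
      fix q q' assume *: "q \<in> {q \<in> J. q i = Q}" "q' \<in> {q \<in> J. q i = Q}"
        "\<And>j. Suc i \<le> j \<Longrightarrow> j < n \<Longrightarrow> q j = q' j"
      show "q = q'"
      proof (rule step.prems(2))
        fix j assume "i \<le> j" "j < n"
        then show "q j = q' j"
          using * by (cases "j = i") auto
      qed (use * J in auto)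
    next
      fix q j assume "q \<in> {q \<in> J. q i = Q}" "sexp j = 0"
      then show "q j = 0"
        using step.prems(3) [of q j] J(3) by blast
    qed (use J k' in auto)
    \<comment> \<open>A second copy of the sign cancels the first; primality then removes the power
      of the derivative of \<open>g\<close>.\<close>
    then have "(-1) ^ (sexp i * Q) * k' q1 \<in> P"
      by (intro P_mult polys_power polys_uminus) auto
    moreover have "(-1) ^ (sexp i * Q) * k' q1 = dpart i (sexp i) g ^ Q * k q1"
      unfolding k'_def by (simp flip: mult.assoc power_mult_distrib)
    ultimately have "dpart i (sexp i) g ^ Q * k q1 \<in> P"
      by simp
    moreover have "Q = 0 \<or> dpart i (sexp i) g \<notin> P"
      using g(4) q1(2) subsetD [OF J(3) q1(1)] step.prems(3) [of q1 i] by auto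
    ultimately have "k q1 \<in> P"
      using gp q1 J(3) step.prems(4) by (intro P_prime_power [of "dpart i (sexp i) g" "k q1" Q] polys_dpart) auto
    then show False
      using q1 by (simp add: J_def)
  qed
qed

end

section \<open>The family indexed by exponent vectors\<close>

definition rem_mon :: "(nat \<Rightarrow> nat) \<Rightarrow> (nat \<Rightarrow>\<^sub>0 nat) \<Rightarrow> (nat \<Rightarrow>\<^sub>0 nat)" where
  "rem_mon s b = Poly_Mapping.mapp (\<lambda>j x. x mod s j) b"

lemma lookup_rem_mon: "lookup (rem_mon s b) j = lookup b j mod s j"
  by (simp add: rem_mon_def lookup_mapp when_def in_keys_iff)

lemma rem_mon_mons: "b \<in> mons n \<Longrightarrow> rem_mon s b \<in> mons n"
  by (simp add: mons_iff lookup_rem_mon)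

definition ind_family ::
    "nat \<Rightarrow> (nat \<Rightarrow> nat) \<Rightarrow> 'k::field mpoly fract \<Rightarrow> (nat \<Rightarrow>\<^sub>0 nat) \<Rightarrow> 'k mpoly fract" where
  "ind_family n s w b =
     iter_fder [0..<n] (\<lambda>j. s j * (lookup b j div s j)) (emb (single (rem_mon s b) 1) * w)"

text \<open>Terms with the same quotients \<open>q\<close> combine into one polynomial
  \<open>k q\<close> with reduced exponents. It lies in \<open>P\<close> by
  \<open>coefficients_in_P\<close> and is 0 by \<open>reduced_in_P_eq_0\<close>. Quotient and
  remainder determine \<open>b\<close>, so \<open>c b\<close> is a single coefficient of
  \<open>k q\<close>.\<close>

lemma (in assoc_element) ind_family_independent:
  assumes I: "finite I" "I \<subseteq> mons n"
    and sum: "(\<Sum>b\<in>I. emb (single 0 (c b)) * ind_family n sexp w b) \<in> A"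
    and b: "b \<in> I"
  shows "c b = 0"
proof -
  let ?q = "\<lambda>b j. lookup b j div sexp j"
  define k where "k q = (\<Sum>b\<in>{b \<in> I. ?q b = q}. single (rem_mon sexp b) (c b))" for q
  have kp: "k q \<in> polys n" for q
    unfolding k_def using I by (intro polys_sum polys_single rem_mon_mons) auto
  have "(\<Sum>b\<in>I. emb (single 0 (c b)) * ind_family n sexp w b) =
      (\<Sum>q\<in>?q ` I. \<Sum>b\<in>{b \<in> I. ?q b = q}. emb (single 0 (c b)) * ind_family n sexp w b)"
    by (rule sum.image_gen [OF I(1)])
  also have "\<dots> = (\<Sum>q\<in>?q ` I. iter_fder [0..<n] (\<lambda>j. sexp j * q j) (emb (k q) * w))"
  proof (intro sum.cong refl)
    fix q
    have "emb (single 0 (c b)) * ind_family n sexp w b =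
        iter_fder [0..<n] (\<lambda>j. sexp j * q j) (emb (single (rem_mon sexp b) (c b)) * w)"
      if "b \<in> {b \<in> I. ?q b = q}" for b
    proof -
      have q: "q = ?q b"
        using that by simp
      have "emb (single (rem_mon sexp b) (c b)) * w =
          emb (single 0 (c b)) * (emb (single (rem_mon sexp b) 1) * w)"
        by (simp add: mult_single flip: mult.assoc emb_mult)
      then show ?thesis
        unfolding q ind_family_def
        by (simp only:) (rule iter_fder_mult_const [symmetric], rule polys_single, simp)
    qed
    then show "(\<Sum>b\<in>{b \<in> I. ?q b = q}. emb (single 0 (c b)) * ind_family n sexp w b) =
        iter_fder [0..<n] (\<lambda>j. sexp j * q j) (emb (k q) * w)"
      by (simp add: k_def emb_sum sum_distrib_right iter_fder_sum)
  qed
  finally have "(\<Sum>q\<in>?q ` I. iter_fder [0..<n] (\<lambda>j. sexp j * q j) (emb (k q) * w)) \<in> A"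
    using sum by simp
  then have kP: "k (?q b) \<in> P"
  proof (rule coefficients_in_P [rotated -2])
    show "?q b \<in> ?q ` I"
      using b by blast
  next
    fix q q' assume *: "q \<in> ?q ` I" "q' \<in> ?q ` I" "\<And>j. 0 \<le> j \<Longrightarrow> j < n \<Longrightarrow> q j = q' j"
    show "q = q'"
    proof
      fix j
      show "q j = q' j"
      proof (cases "j < n")
        case False
        then have "lookup b j = 0" if "b \<in> I" for b
          using I that by (auto simp: mons_iff)
        then show ?thesis
          using *(1,2) by auto
      qed (use *(3) in auto)
    qed
  qed (use I kp in auto)
  have key: "\<exists>b'\<in>I. m = rem_mon sexp b'" if "m \<in> keys (k q)" for m q
    using that keys_sum [of "\<lambda>b. single (rem_mon sexp b) (c b)" "{b \<in> I. ?q b = q}"]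
    unfolding k_def by (fastforce split: if_splits)
  have "k (?q b) = 0"
  proof (rule reduced_in_P_eq_0 [of n])
    fix m i assume "m \<in> keys (k (?q b))"
    then obtain b' where "m = rem_mon sexp b'"
      using key by blast
    then show "sexp i = 0 \<or> lookup m i < sexp i"
      by (cases "sexp i = 0") (simp_all add: lookup_rem_mon)
  qed (use kp kP in auto)
  moreover have "lookup (k (?q b)) (rem_mon sexp b) =
      (\<Sum>b'\<in>{b' \<in> I. ?q b' = ?q b}. if b' = b then c b else 0)"
    unfolding k_def lookup_sum lookup_single
  proof (intro sum.cong refl)
    fix b' assume b': "b' \<in> {b' \<in> I. ?q b' = ?q b}"
    have "b' = b" if "rem_mon sexp b' = rem_mon sexp b"
    proof (rule poly_mapping_eqI)
      fix j
      have "lookup b' j mod sexp j = lookup b j mod sexp j"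
        using that by (metis lookup_rem_mon)
      moreover have "lookup b' j div sexp j = lookup b j div sexp j"
        using b' by (auto dest: fun_cong [of _ _ j])
      ultimately show "lookup b' j = lookup b j"
        by (metis div_mult_mod_eq)
    qed
    then show "(c b' when rem_mon sexp b' = rem_mon sexp b) = (if b' = b then c b else 0)"
      by (auto simp: when_def)
  qed
  then have "lookup (k (?q b)) (rem_mon sexp b) = c b"
    using b I by simp
  ultimately show ?thesis
    by simp
qed

text \<open>An element of \<open>B - A\<close> with maximal annihilator fits the locale: its
  multiples stay in \<open>B\<close>, and passing to a multiple can only enlarge the
  annihilator.\<close>

lemma ind_family_exists:
  assumes A: "dsub n A" and B: "dsub n B" and AB: "A \<subset> B"
  obtains w s where "w \<in> B"
    "\<And>I c b. finite I \<Longrightarrow> I \<subseteq> mons n \<Longrightarrow>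
       (\<Sum>b\<in>I. emb (single 0 (c b)) * ind_family n s w b) \<in> A \<Longrightarrow> b \<in> I \<Longrightarrow> c b = 0"
proof -
  obtain w where w: "w \<in> B - A"
    "\<And>v. v \<in> B - A \<Longrightarrow> ann n A w \<subseteq> ann n A v \<Longrightarrow> ann n A v = ann n A w"
    using ann_maximal [OF A, of B] AB by (metis Diff_eq_empty_iff psubsetE)
  have wB: "w \<in> B"
    using w(1) by simp
  interpret assoc_element n A w
  proof
    fix g assume g: "g \<in> polys n" "emb g * w \<notin> A"
    have "h \<in> ann n A (emb g * w)" if "h \<in> ann n A w" for h
      using that dsub_mult [OF A g(1)] by (auto simp: ann_def mult.left_commute)
    then show "ann n A (emb g * w) = ann n A w"
      using g w(1) dsub_mult [OF B g(1)] by (intro w(2)) auto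
  qed (use A w in auto)
  show thesis
    using wB ind_family_independent by (intro that [of w sexp]) auto
qed

lemma ind_family_dsub:
  assumes "dsub n B" "w \<in> B" "b \<in> mons n"
  shows "ind_family n s w b \<in> B"
  unfolding ind_family_def using assms
  by (intro iter_fder_dsub [of n] dsub_mult [of n] polys_single rem_mon_mons) auto

section \<open>Counting dimensions\<close>

definition bmons :: "nat \<Rightarrow> nat \<Rightarrow> (nat \<Rightarrow>\<^sub>0 nat) set" where
  "bmons n j = {b \<in> mons n. mdeg b \<le> j}"

lemma lookup_inj_on_mons: "inj_on (\<lambda>b. restrict (lookup b) {..<n}) (mons n)"
proof (rule inj_onI, rule poly_mapping_eqI)
  fix a b :: "nat \<Rightarrow>\<^sub>0 nat" and i
  assume ab: "a \<in> mons n" "b \<in> mons n" "restrict (lookup a) {..<n} = restrict (lookup b) {..<n}"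
  show "lookup a i = lookup b i"
    using ab(1,2) fun_cong [OF ab(3), of i] by (cases "i < n") (auto simp: mons_iff)
qed

lemma lookup_le_mdeg: "lookup b i \<le> mdeg b"
  unfolding mdeg_def by (cases "i \<in> keys b") (auto simp: in_keys_iff intro: member_le_sum)

lemma finite_bmons: "finite (bmons n j)"
  and card_bmons_le: "card (bmons n j) \<le> (j + 1) ^ n"
proof -
  let ?S = "{..<n} \<rightarrow>\<^sub>E {..j}"
  have fin: "finite ?S"
    by (intro finite_PiE) auto
  have inj: "inj_on (\<lambda>b. restrict (lookup b) {..<n}) (bmons n j)"
    using lookup_inj_on_mons by (rule inj_on_subset) (auto simp: bmons_def)
  have sub: "(\<lambda>b. restrict (lookup b) {..<n}) ` bmons n j \<subseteq> ?S"
    using order_trans [OF lookup_le_mdeg]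
    by (intro image_subsetI) (simp add: bmons_def restrict_PiE_iff)
  show "finite (bmons n j)"
    using inj sub fin by (rule inj_on_finite)
  have "card (bmons n j) \<le> card ?S"
    using inj sub fin by (rule card_inj_on_le)
  then show "card (bmons n j) \<le> (j + 1) ^ n"
    by (simp add: card_PiE)
qed

text \<open>Divide all exponents by \<open>d + 1\<close>: there are \<open>(d + 1) ^ n\<close>
  possible remainder vectors, and the quotient has degree at most \<open>j\<close>.\<close>

lemma card_bmons_mult_le:
  "card (bmons n ((d + 1) * j)) \<le> (d + 1) ^ n * card (bmons n j)"
proof -
  let ?S = "({..<n} \<rightarrow>\<^sub>E {..d}) \<times> bmons n j"
  define quo where "quo = (\<lambda>b :: nat \<Rightarrow>\<^sub>0 nat. Poly_Mapping.mapp (\<lambda>_ x. x div (d + 1)) b)"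
  have quo: "lookup (quo b) i = lookup b i div (d + 1)" for b i
    by (simp add: quo_def lookup_mapp when_def in_keys_iff)
  let ?F = "\<lambda>b. (restrict (\<lambda>i. lookup b i mod (d + 1)) {..<n}, quo b)"
  have "card (bmons n ((d + 1) * j)) \<le> card ?S"
  proof (rule card_inj_on_le [of ?F])
    show "inj_on ?F (bmons n ((d + 1) * j))"
    proof (rule inj_onI, rule poly_mapping_eqI)
      fix a b i
      assume ab: "a \<in> bmons n ((d + 1) * j)" "b \<in> bmons n ((d + 1) * j)" "?F a = ?F b"
      show "lookup a i = lookup b i"
      proof (cases "i < n")
        case True
        have eq: "restrict (\<lambda>i. lookup a i mod (d + 1)) {..<n} =
            restrict (\<lambda>i. lookup b i mod (d + 1)) {..<n}"
          using ab(3) by blast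
        have "lookup a i mod (d + 1) = lookup b i mod (d + 1)"
          using True fun_cong [OF eq, of i] by simp
        moreover have "lookup a i div (d + 1) = lookup b i div (d + 1)"
          using ab(3) quo by (metis snd_conv)
        ultimately show ?thesis
          by (metis div_mult_mod_eq)
      qed (use ab in \<open>auto simp: bmons_def mons_iff\<close>)
    qed
    have "quo b \<in> bmons n j" if b: "b \<in> bmons n ((d + 1) * j)" for b
    proof -
      have m: "b \<in> mons n" "quo b \<in> mons n"
        using b by (auto simp: bmons_def mons_iff quo)
      have "(d + 1) * mdeg (quo b) \<le> mdeg b"
        unfolding mdeg_mons [OF m(1)] mdeg_mons [OF m(2)] sum_distrib_left quo
        by (intro sum_mono) (rule times_div_less_eq_dividend)
      also have "\<dots> \<le> (d + 1) * j"
        using b by (simp add: bmons_def)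
      finally have "mdeg (quo b) \<le> j"
        by (subst (asm) mult_le_cancel1) simp
      with m show ?thesis
        by (simp add: bmons_def)
    qed
    then show "?F ` bmons n ((d + 1) * j) \<subseteq> ?S"
      by (intro image_subsetI) (simp add: restrict_PiE_iff flip: less_Suc_eq_le)
    show "finite ?S"
      by (intro finite_cartesian_product finite_PiE finite_bmons) auto
  qed
  then show ?thesis
    by (simp add: card_cartesian_product card_PiE)
qed

text \<open>If \<open>l > q\<close>, iterating the inequality in steps of \<open>c\<close> makes
  \<open>N (k * c)\<close> grow at least like \<open>((q + 1) / q) ^ k\<close>, which exceeds any
  polynomial in \<open>k\<close>.\<close>

lemma polynomial_growth_bound:
  fixes N :: "nat \<Rightarrow> nat"
  assumes ineq: "\<And>j. l * N j \<le> q * N (j + c)" and bound: "\<And>j. N j \<le> (j + 1) ^ n"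
    and "N 0 > 0" "q > 0"
  shows "l \<le> q"
proof (rule ccontr)
  assume "\<not> l \<le> q"
  then have step: "(q + 1) * N j \<le> q * N (j + c)" for j
    using ineq [of j] mult_le_mono1 [of "q + 1" l "N j"] by simp
  have "(q + 1) ^ k * N 0 \<le> q ^ k * N (k * c)" for k
  proof (induction k)
    case (Suc k)
    have "(q + 1) ^ Suc k * N 0 \<le> (q + 1) * (q ^ k * N (k * c))"
      using mult_le_mono2 [OF Suc, of "q + 1"] by (simp only: power_Suc mult.assoc)
    also have "\<dots> = q ^ k * ((q + 1) * N (k * c))"
      by (simp only: mult.left_commute)
    also have "\<dots> \<le> q ^ k * (q * N (k * c + c))"
      by (intro mult_le_mono2 step)
    finally show ?case
      by (simp add: algebra_simps)
  qed simp
  moreover have "(q + 1) ^ k \<le> (q + 1) ^ k * N 0" for k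
    using \<open>N 0 > 0\<close> by simp
  moreover have "q ^ k * N (k * c) \<le> q ^ k * (k * c + 1) ^ n" for k
    using bound by (intro mult_le_mono2)
  ultimately have "(q + 1) ^ k \<le> q ^ k * (k * c + 1) ^ n" for k
    by (meson order_trans)
  then have le_real: "real ((q + 1) ^ k) \<le> real (q ^ k * (k * c + 1) ^ n)" for k
    by (simp only: of_nat_le_iff)
  define a where "a = (real q + 1) / real q"
  have le: "a ^ k \<le> (real k * real c + 1) ^ n" for k
    using \<open>q > 0\<close> le_real [of k] by (simp add: a_def power_divide field_simps)
  have a: "a > 1"
    using \<open>q > 0\<close> by (simp add: a_def)
  \<comment> \<open>Rescales \<open>(c + 1) * k\<close> to \<open>k * ln a\<close>, so that the
    limit of a power over \<open>exp\<close> applies.\<close>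
  define C where "C = ((real c + 1) / ln a) ^ n"
  have C: "C * (real k * ln a) ^ n = ((real c + 1) * real k) ^ n" for k
    using a by (simp add: C_def flip: power_mult_distrib)
  have "filterlim (\<lambda>k. real k * ln a) at_top sequentially"
    using a by (intro filterlim_at_top_mult_tendsto_pos [OF tendsto_const _ filterlim_real_sequentially]) simp
  from tendsto_mult_right_zero [OF filterlim_compose [OF tendsto_power_div_exp_0 [of n] this], of C]
  have "\<forall>\<^sub>F k in sequentially. C * ((real k * ln a) ^ n / exp (real k * ln a)) < 1"
    by (rule order_tendstoD) simp
  \<comment> \<open>\<open>k > 0\<close> is kept for the later estimate
    \<open>k * c + 1 \<le> (c + 1) * k\<close>.\<close>
  then have "\<forall>\<^sub>F k in sequentially. C * ((real k * ln a) ^ n / exp (real k * ln a)) < 1 \<and> k > 0"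
    using eventually_gt_at_top by (rule eventually_conj)
  then obtain k where k: "C * ((real k * ln a) ^ n / exp (real k * ln a)) < 1" "k > 0"
    using eventually_happens by fastforce
  have "exp (real k * ln a) = a ^ k"
    using a by (simp add: exp_of_nat_mult)
  with k(1) have "C * (real k * ln a) ^ n < a ^ k"
    using a by (simp add: field_simps)
  moreover have "(real k * real c + 1) ^ n \<le> ((real c + 1) * real k) ^ n"
    using k(2) by (intro power_mono) (simp_all add: algebra_simps)
  ultimately show False
    using le [of k] by (simp add: C)
qed

section \<open>Linear algebra over the ground field\<close>

interpretation fract_vs: vector_space "\<lambda>(c :: 'k::field) h. emb (single 0 c) * h"
  by unfold_locales
    (simp_all add: single_add emb_add algebra_simps flip: emb_mult, simp add: mult_single emb_mult)

lemma card_le_of_independent_family: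
  fixes u :: "'i \<Rightarrow> 'k::field mpoly fract"
  assumes "finite J" "finite T" "u ` J \<subseteq> fract_vs.span T"
    and ind: "\<And>c x. (\<Sum>x\<in>J. emb (single 0 (c x)) * u x) = 0 \<Longrightarrow> x \<in> J \<Longrightarrow> c x = 0"
  shows "card J \<le> card T"
proof -
  have inj: "inj_on u J"
  proof (rule inj_onI, rule ccontr)
    fix x y assume xy: "x \<in> J" "y \<in> J" "u x = u y" "x \<noteq> y"
    let ?c = "\<lambda>z. if z = x then 1 else if z = y then - 1 else 0 :: 'k"
    have "(\<Sum>z\<in>J. emb (single 0 (?c z)) * u z) = (\<Sum>z\<in>{x, y}. emb (single 0 (?c z)) * u z)"
      using xy \<open>finite J\<close> by (intro sum.mono_neutral_right) auto
    also have "\<dots> = 0"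
      using xy by (simp add: single_uminus emb_uminus)
    finally show False
      using ind [of ?c x] xy by simp
  qed
  have "fract_vs.independent (u ` J)"
  proof (rule fract_vs.independent_if_scalars_zero)
    fix c v assume "(\<Sum>v\<in>u ` J. emb (single 0 (c v)) * v) = 0" "v \<in> u ` J"
    then show "c v = 0"
      using ind [of "\<lambda>x. c (u x)"] by (auto simp: sum.reindex [OF inj])
  qed (use assms in auto)
  then have "card (u ` J) \<le> card T"
    using fract_vs.independent_span_bound assms by blast
  then show ?thesis
    by (simp add: card_image inj)
qed

section \<open>The filtration of the localization by pole order and numerator degree\<close>

definition loc_filt :: "'k::field mpoly \<Rightarrow> nat \<Rightarrow> nat \<Rightarrow> nat \<Rightarrow> 'k mpoly fract set" where
  "loc_filt f n j e = (\<lambda>g. emb g / emb f ^ j) ` bpolys n e"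

locale localization =
  fixes f :: "'k::field mpoly" and n d :: nat
  assumes f: "f \<noteq> 0" "f \<in> bpolys n d"
begin

abbreviation "W \<equiv> loc_filt f n"

lemma W_add: "u \<in> W j e \<Longrightarrow> v \<in> W j e \<Longrightarrow> u + v \<in> W j e"
  by (auto simp: loc_filt_def image_iff) (metis add_divide_distrib bpolys_add emb_add)

lemma W_zero: "0 \<in> W j e"
  by (auto simp: loc_filt_def image_iff intro!: bexI [of _ 0])

lemma W_uminus: "v \<in> W j e \<Longrightarrow> - v \<in> W j e"
  by (auto simp: loc_filt_def image_iff) (metis bpolys_uminus emb_uminus minus_divide_left)

lemma W_sum: "(\<And>x. x \<in> S \<Longrightarrow> g x \<in> W j e) \<Longrightarrow> sum g S \<in> W j e"
  by (induction S rule: infinite_finite_induct) (auto intro: W_add W_zero)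

lemma W_mult:
  assumes "u \<in> W j e" "v \<in> W j' e'"
  shows "u * v \<in> W (j + j') (e + e')"
proof -
  obtain g h where "g \<in> bpolys n e" "h \<in> bpolys n e'" "u = emb g / emb f ^ j" "v = emb h / emb f ^ j'"
    using assms by (auto simp: loc_filt_def)
  then show ?thesis
    unfolding loc_filt_def
    by (intro image_eqI [of _ _ "g * h"] bpolys_mult) (simp_all add: emb_mult power_add)
qed

lemma W_mono: "v \<in> W j e \<Longrightarrow> e \<le> e' \<Longrightarrow> v \<in> W j e'"
  by (auto simp: loc_filt_def intro: bpolys_mono)

lemma W_emb: "g \<in> bpolys n e \<Longrightarrow> emb g \<in> W 0 e"
  by (simp add: loc_filt_def)

lemma W_raise:
  assumes "v \<in> W j e"
  shows "v \<in> W (j + a) (e + a * d)"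
proof -
  have "1 \<in> W a (a * d)"
    unfolding loc_filt_def using f
    by (intro image_eqI [of _ _ "f ^ a"] bpolys_power) (simp_all add: emb_power)
  from W_mult [OF assms this] show ?thesis
    by simp
qed

text \<open>The Leibniz rule for \<open>f * (1 / f) = 1\<close> is solved for the highest derivative
  of \<open>1 / f\<close>.\<close>

lemma fder_inverse_W: "fder i t (1 / emb f) \<in> W (t + 1) (t * d)"
proof (induction t rule: less_induct)
  case (less t)
  show ?case
  proof (cases "t = 0")
    case True
    show ?thesis
      unfolding True loc_filt_def by (intro image_eqI [of _ _ 1]) simp_all
  next
    case False
    have "0 = fder i t (emb f * (1 / emb f))"
      using f(1) False fder_emb [of i t 1] by (simp add: dpart_one)
    also have "\<dots> = (\<Sum>a\<le>t. emb (dpart i a f) * fder i (t - a) (1 / emb f))"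
      unfolding fder_mult fder_emb ..
    also have "\<dots> = emb f * fder i t (1 / emb f) +
        (\<Sum>a=1..t. emb (dpart i a f) * fder i (t - a) (1 / emb f))"
      by (simp add: atMost_atLeast0 sum.atLeast_Suc_atMost)
    finally have eq: "fder i t (1 / emb f) =
        (1 / emb f) * - (\<Sum>a=1..t. emb (dpart i a f) * fder i (t - a) (1 / emb f))"
      using f(1) by (simp add: field_simps eq_neg_iff_add_eq_0)
    have "emb (dpart i a f) * fder i (t - a) (1 / emb f) \<in> W t (t * d)" if a: "a \<in> {1..t}" for a
    proof -
      have "emb (dpart i a f) * fder i (t - a) (1 / emb f) \<in> W (0 + (t - a + 1)) (d + (t - a) * d)"
        using a f(2) by (intro W_mult W_emb bpolys_dpart less) auto
      \<comment> \<open>Brings all summands to the common pole order \<open>t\<close>; the numerator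
        bound grows from \<open>(t - a + 1) * d\<close> to \<open>t * d\<close>.\<close>
      from W_raise [OF this, of "a - 1"]
      have "emb (dpart i a f) * fder i (t - a) (1 / emb f) \<in>
          W (t - a + 1 + (a - 1)) ((1 + (t - a) + (a - 1)) * d)"
        by (simp add: algebra_simps)
      moreover have "t - a + 1 + (a - 1) = t" "1 + (t - a) + (a - 1) = t"
        using a by auto
      ultimately show ?thesis
        by simp
    qed
    then have "- (\<Sum>a=1..t. emb (dpart i a f) * fder i (t - a) (1 / emb f)) \<in> W t (t * d)"
      by (intro W_uminus W_sum)
    moreover have "1 / emb f \<in> W 1 0"
      unfolding loc_filt_def by (intro image_eqI [of _ _ 1]) simp_all
    ultimately have "fder i t (1 / emb f) \<in> W (1 + t) (0 + t * d)"
      unfolding eq by (intro W_mult)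
    then show ?thesis
      by simp
  qed
qed

text \<open>Splitting off one factor \<open>1 / f\<close> at a time adds only \<open>t\<close> to
  the pole order, whereas the formula in \<open>dact\<close> multiplies it by
  \<open>t + 1\<close>.\<close>

lemma fder_W: "v \<in> W j e \<Longrightarrow> fder i t v \<in> W (j + t) (e + t * d)"
proof (induction j arbitrary: v t)
  case 0
  then obtain g where g: "g \<in> bpolys n e" "v = emb g"
    by (auto simp: loc_filt_def)
  have "fder i t v \<in> W 0 e"
    unfolding g(2) fder_emb by (intro W_emb bpolys_dpart g)
  then show ?case
    by (rule W_raise)
next
  case (Suc j)
  then obtain g where g: "g \<in> bpolys n e" "v = emb g / emb f ^ Suc j"
    by (auto simp: loc_filt_def)
  have "fder i t v = fder i t ((emb g / emb f ^ j) * (1 / emb f))"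
    unfolding g(2) by (simp add: mult.commute)
  also have "\<dots> \<in> W (Suc j + t) (e + t * d)"
    unfolding fder_mult
  proof (rule W_sum)
    fix a assume a: "a \<in> {..t}"
    have "emb g / emb f ^ j \<in> W j e"
      using g by (auto simp: loc_filt_def)
    then have "fder i a (emb g / emb f ^ j) * fder i (t - a) (1 / emb f) \<in>
        W ((j + a) + (t - a + 1)) ((e + a * d) + (t - a) * d)"
      by (intro W_mult Suc.IH fder_inverse_W)
    moreover have "(j + a) + (t - a + 1) = Suc j + t"
      using a by auto
    moreover have "(e + a * d) + (t - a) * d = e + t * d"
      using a by (simp add: add.assoc flip: add_mult_distrib)
    ultimately show "fder i a (emb g / emb f ^ j) * fder i (t - a) (1 / emb f) \<in>
        W (Suc j + t) (e + t * d)"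
      by simp
  qed
  finally show ?case .
qed

text \<open>Raising the pole order by one costs \<open>d\<close> in the numerator; slope
  \<open>d + 1\<close> leaves room for multiplication by one further variable.\<close>

definition V :: "nat \<Rightarrow> 'k mpoly fract set" where
  "V j = W j (j * (d + 1))"

lemma V_mono:
  assumes "v \<in> V j" "j \<le> j'"
  shows "v \<in> V j'"
proof -
  have "v \<in> W (j + (j' - j)) (j * (d + 1) + (j' - j) * d)"
    using assms unfolding V_def by (intro W_raise)
  then have "v \<in> W j' (j * (d + 1) + (j' - j) * d)"
    using assms by simp
  moreover have "j * (d + 1) + (j' - j) * d \<le> j * (d + 1) + (j' - j) * (d + 1)"
    by simp
  then have "j * (d + 1) + (j' - j) * d \<le> j' * (d + 1)"
    using assms(2) by (simp only: add_mult_distrib [symmetric] le_add_diff_inverse)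
  ultimately show ?thesis
    unfolding V_def by (rule W_mono)
qed

lemma fder_V: "v \<in> V j \<Longrightarrow> fder i t v \<in> V (j + t)"
  unfolding V_def by (rule W_mono [OF fder_W]) (auto simp: algebra_simps)

lemma mon_V:
  assumes "v \<in> V j" "m \<in> mons n"
  shows "emb (single m c) * v \<in> V (j + mdeg m)"
proof -
  have "emb (single m c) * v \<in> W (0 + j) (mdeg m + j * (d + 1))"
    using assms unfolding V_def by (intro W_mult W_emb bpolys_single) auto
  from W_raise [OF this, of "mdeg m"] show ?thesis
    unfolding V_def by (simp add: algebra_simps)
qed

lemma iter_fder_V: "v \<in> V j \<Longrightarrow> iter_fder js e v \<in> V (j + sum_list (map e js))"
proof (induction js arbitrary: v j)
  case (Cons i js)
  from Cons.IH [OF fder_V [OF Cons.prems, of i "e i"]] show ?case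
    by (simp add: add.assoc)
qed simp

text \<open>Degree of the remainder plus orders of the derivatives is exactly \<open>mdeg b\<close>,
  and each unit costs one step of the filtration.\<close>

lemma ind_family_V:
  assumes "w \<in> V j" "b \<in> mons n"
  shows "ind_family n s w b \<in> V (j + mdeg b)"
proof -
  have "mdeg b = mdeg (rem_mon s b) + sum_list (map (\<lambda>i. s i * (lookup b i div s i)) [0..<n])"
    unfolding mdeg_mons [OF assms(2)] mdeg_mons [OF rem_mon_mons [OF assms(2)]] lookup_rem_mon
    by (simp add: interv_sum_list_conv_sum_set_nat atLeast0LessThan flip: sum.distrib)
  then show ?thesis
    using iter_fder_V [OF mon_V [OF assms(1) rem_mon_mons [OF assms(2)]]]
    unfolding ind_family_def by (simp add: add.assoc)
qed

lemma V_span: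
  "V j \<subseteq> fract_vs.span ((\<lambda>m. emb (single m 1) / emb f ^ j) ` bmons n ((d + 1) * j))"
proof
  fix v assume "v \<in> V j"
  then obtain g where g: "g \<in> bpolys n ((d + 1) * j)" "v = emb g / emb f ^ j"
    by (auto simp: V_def loc_filt_def mult.commute)
  have "emb g = (\<Sum>m\<in>keys g. emb (single 0 (lookup g m)) * emb (single m 1))"
    by (subst mpoly_sum_single [of g]) (simp add: emb_sum mult_single flip: emb_mult)
  then have "v = (\<Sum>m\<in>keys g. emb (single 0 (lookup g m)) * (emb (single m 1) / emb f ^ j))"
    by (simp add: g(2) sum_divide_distrib)
  also have "\<dots> \<in> fract_vs.span ((\<lambda>m. emb (single m 1) / emb f ^ j) ` bmons n ((d + 1) * j))"
    using g(1)
    by (intro fract_vs.span_sum fract_vs.span_scale fract_vs.span_base imageI)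
      (auto simp: bpolys_def bmons_def)
  finally show "v \<in> fract_vs.span ((\<lambda>m. emb (single m 1) / emb f ^ j) ` bmons n ((d + 1) * j))" .
qed

text \<open>If the numerator has degree at most \<open>e\<close>, expanding the fraction by
  \<open>f ^ e\<close> suffices: \<open>e + e * d\<close> is at most
  \<open>(snd p + e) * (d + 1)\<close>.\<close>

lemma phi_V:
  assumes "fst p \<in> polys n"
  obtains j where "phi f p \<in> V j"
proof -
  obtain e where "fst p \<in> bpolys n e"
    using assms polys_ex_bpolys by blast
  then have "phi f p \<in> W (snd p) e"
    using f by (auto simp: loc_filt_def phi_alt)
  then have "phi f p \<in> W (snd p + e) (e + e * d)"
    by (rule W_raise)
  then have "phi f p \<in> V (snd p + e)"
    unfolding V_def by (rule W_mono) (simp add: algebra_simps)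
  then show thesis
    by (rule that)
qed

text \<open>Each step of the chain supplies a family in \<open>N (Suc j)\<close> independent modulo
  \<open>N j\<close>; together these are independent. Counting the members that lie in
  \<open>V (j + c)\<close> against its spanning set gives the inequality for
  \<open>polynomial_growth_bound\<close>.\<close>

lemma chain_length_le:
  assumes N: "\<And>j. j \<le> l \<Longrightarrow> dsub n (N j)" and strict: "\<And>j. j < l \<Longrightarrow> N j \<subset> N (Suc j)"
    and loc: "\<And>j. j \<le> l \<Longrightarrow> N j \<subseteq> (\<Union>c. V c)"
  shows "l \<le> (d + 1) ^ n"
proof -
  define good where "good j w s c \<longleftrightarrow> w \<in> N (Suc j) \<and> w \<in> V c \<and>
      (\<forall>I a b. finite I \<longrightarrow> I \<subseteq> mons n \<longrightarrow>
        (\<Sum>b\<in>I. emb (single 0 (a b)) * ind_family n s w b) \<in> N j \<longrightarrow> b \<in> I \<longrightarrow> a b = 0)" for j w s c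
  have "\<exists>w s c. good j w s c" if j: "j < l" for j
  proof (rule ind_family_exists [of n "N j" "N (Suc j)"])
    fix w s
    assume w: "w \<in> N (Suc j)" and ind: "\<And>I a b. finite I \<Longrightarrow> I \<subseteq> mons n \<Longrightarrow>
      (\<Sum>b\<in>I. emb (single 0 (a b)) * ind_family n s w b) \<in> N j \<Longrightarrow> b \<in> I \<Longrightarrow> a b = 0"
    have "w \<in> (\<Union>c. V c)"
      using w loc [of "Suc j"] j by (meson Suc_leI subsetD)
    then obtain c where "w \<in> V c"
      by blast
    then have "good j w s c"
      unfolding good_def using w ind by blast
    then show ?thesis
      by blast
  qed (use N strict j in auto)
  then obtain w s cc where "\<And>j. j < l \<Longrightarrow> good j (w j) (s j) (cc j)"
    by metis
  then have w: "\<And>j. j < l \<Longrightarrow> w j \<in> N (Suc j)"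
    and wV: "\<And>j. j < l \<Longrightarrow> w j \<in> V (cc j)"
    and ind: "\<And>j I a b. j < l \<Longrightarrow> finite I \<Longrightarrow> I \<subseteq> mons n \<Longrightarrow>
      (\<Sum>b\<in>I. emb (single 0 (a b)) * ind_family n (s j) (w j) b) \<in> N j \<Longrightarrow> b \<in> I \<Longrightarrow> a b = 0"
    unfolding good_def by blast+
  \<comment> \<open>A common filtration level for all generators \<open>w j\<close>, independent of
    the level at which members are counted.\<close>
  define c where "c = (\<Sum>j<l. cc j)"
  have wVc: "w j \<in> V c" if "j < l" for j
    using wV [OF that] by (rule V_mono) (use that in \<open>auto simp: c_def intro: member_le_sum\<close>)
  have mono: "N i \<subseteq> N j" if "i \<le> j" "j \<le> l" for i j
    using that
  proof (induction j rule: dec_induct)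
    case (step k)
    then show ?case
      using strict [of k] by auto
  qed simp
  let ?u = "\<lambda>(m, b). ind_family n (s m) (w m) b"
  have count: "l * card (bmons n j) \<le> (d + 1) ^ n * card (bmons n (j + c))" for j
  proof -
    let ?B = "bmons n j"
    let ?T = "(\<lambda>m. emb (single m 1) / emb f ^ (j + c)) ` bmons n ((d + 1) * (j + c))"
    \<comment> \<open>The topmost block is peeled off first: all earlier blocks lie in
      \<open>N L\<close>, modulo which the block of index \<open>L\<close> is independent.\<close>
    have zero: "a (m, b) = 0"
      if "L \<le> l" "(\<Sum>m<L. \<Sum>b\<in>?B. emb (single 0 (a (m, b))) * ?u (m, b)) = 0" "m < L" "b \<in> ?B"
      for L a m b
      using that
    proof (induction L)
      case (Suc L)
      let ?R = "\<Sum>m<L. \<Sum>b\<in>?B. emb (single 0 (a (m, b))) * ?u (m, b)"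
      let ?S = "\<Sum>b\<in>?B. emb (single 0 (a (L, b))) * ?u (L, b)"
      have NL: "dsub n (N L)"
        using Suc.prems N by simp
      have "?u (m, b) \<in> N L" if "m < L" "b \<in> ?B" for m b
      proof -
        have "?u (m, b) \<in> N (Suc m)"
          using that Suc.prems w [of m] N [of "Suc m"]
          by (auto simp: bmons_def intro!: ind_family_dsub)
        then show ?thesis
          using mono [of "Suc m" L] that Suc.prems by auto
      qed
      then have "?R \<in> N L"
        by (intro dsub_sum [OF NL] dsub_mult [OF NL] polys_single) auto
      moreover have "?S = - ?R"
        using Suc.prems(2) by (simp add: eq_neg_iff_add_eq_0 add.commute)
      ultimately have "?S \<in> N L"
        using dsub_uminus [OF NL] by simp
      then have SL: "a (L, b) = 0" if "b \<in> ?B" for b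
        using ind [of L ?B "\<lambda>b. a (L, b)" b] that Suc.prems finite_bmons by (auto simp: bmons_def)
      then have "?S = 0"
        by simp
      then have "?R = 0"
        using Suc.prems(2) by simp
      then show ?case
        using Suc SL by (cases "m = L") auto
    qed simp
    have "card ({..<l} \<times> ?B) \<le> card ?T"
    proof (rule card_le_of_independent_family [of _ _ ?u])
      fix a x
      assume "(\<Sum>x\<in>{..<l} \<times> ?B. emb (single 0 (a x)) * ?u x) = 0" "x \<in> {..<l} \<times> ?B"
      then show "a x = 0"
        using zero [of l a "fst x" "snd x"]
        by (auto simp: sum.cartesian_product case_prod_unfold)
    next
      have "?u (m, b) \<in> V (j + c)" if "m < l" "b \<in> ?B" for m b
        using ind_family_V [OF wVc [OF that(1)], of b "s m"] that(2)
        by (auto simp: bmons_def intro: V_mono)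
      then show "?u ` ({..<l} \<times> ?B) \<subseteq> fract_vs.span ?T"
        using V_span [of "j + c"] by auto
    qed (simp_all add: finite_bmons)
    also have "\<dots> \<le> card (bmons n ((d + 1) * (j + c)))"
      by (rule card_image_le [OF finite_bmons])
    also have "\<dots> \<le> (d + 1) ^ n * card (bmons n (j + c))"
      by (rule card_bmons_mult_le)
    finally show ?thesis
      by (simp add: card_cartesian_product)
  qed
  show ?thesis
  proof (rule polynomial_growth_bound [of l "\<lambda>j. card (bmons n j)"])
    have "0 \<in> bmons n 0"
      by (simp add: bmons_def)
    then show "0 < card (bmons n 0)"
      using finite_bmons by (auto simp: card_gt_0_iff)
  qed (use count card_bmons_le in auto)
qed

end

section \<open>From saturated sets of representatives to submodules of the fraction field\<close>

lemma dsubmodD: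
  assumes "dsubmod E f n M"
  shows dsubmod_subset: "M \<subseteq> polys n \<times> UNIV"
    and dsubmod_saturated: "p \<in> M \<Longrightarrow> q \<in> polys n \<times> UNIV \<Longrightarrow> E p q \<Longrightarrow> q \<in> M"
    and dsubmod_zero: "(0, 0) \<in> M"
    and dsubmod_add: "p \<in> M \<Longrightarrow> q \<in> M \<Longrightarrow> loc_add f p q \<in> M"
    and dsubmod_mult: "a \<in> polys n \<Longrightarrow> p \<in> M \<Longrightarrow> (a * fst p, snd p) \<in> M"
    and dsubmod_dact: "i < n \<Longrightarrow> p \<in> M \<Longrightarrow> dact f i t p \<in> M"
  using assms [unfolded dsubmod_def] by blast+

lemma dsubmod_fst_polys: "dsubmod E f n M \<Longrightarrow> p \<in> M \<Longrightarrow> fst p \<in> polys n"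
  using dsubmod_subset by fastforce

lemma dsub_phi_image:
  fixes f :: "'k::field mpoly"
  assumes f: "f \<noteq> 0" and M: "dsubmod E f n M"
  shows "dsub n (phi f ` M)"
  unfolding dsub_def
proof (intro conjI ballI allI impI)
  show "0 \<in> phi f ` M"
    using dsubmod_zero [OF M] by (rule image_eqI [rotated]) (simp add: phi_alt f)
next
  fix u v assume "u \<in> phi f ` M" "v \<in> phi f ` M"
  then obtain p q where pq: "p \<in> M" "q \<in> M" "u = phi f p" "v = phi f q"
    by blast
  show "u + v \<in> phi f ` M"
    using dsubmod_add [OF M pq(1,2)] by (rule image_eqI [rotated]) (simp add: pq phi_loc_add f)
next
  fix a v assume a: "(a :: 'k mpoly) \<in> polys n" and "v \<in> phi f ` M"
  then obtain p where p: "p \<in> M" "v = phi f p"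
    by blast
  show "emb a * v \<in> phi f ` M"
    using dsubmod_mult [OF M a p(1)] by (rule image_eqI [rotated]) (simp add: p phi_alt f emb_mult)
next
  fix i t v assume i: "i < n" and "v \<in> phi f ` M"
  then obtain p where p: "p \<in> M" "v = phi f p"
    by blast
  show "fder i t v \<in> phi f ` M"
    using dsubmod_dact [OF M i p(1)] by (rule image_eqI [rotated]) (simp add: p phi_dact f)
qed

text \<open>A saturated set is recovered from its image, so strictness survives.\<close>

lemma phi_image_strict:
  assumes f: "f \<noteq> 0" and M: "dsubmod (loc_eq f) f n M" "dsubmod (loc_eq f) f n M'" "M \<subset> M'"
  shows "phi f ` M \<subset> phi f ` M'"
proof -
  obtain p where p: "p \<in> M'" "p \<notin> M"
    using M(3) by blast
  have "phi f p \<notin> phi f ` M"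
  proof
    assume "phi f p \<in> phi f ` M"
    then obtain q where q: "q \<in> M" "phi f q = phi f p"
      by auto
    then have "loc_eq f q p"
      by (simp add: loc_eq_iff_phi f)
    then have "p \<in> M"
      using dsubmod_subset [OF M(2)] p(1) by (intro dsubmod_saturated [OF M(1) q(1)]) auto
    then show False
      using p(2) by contradiction
  qed
  with p M(3) show ?thesis
    by blast
qed

lemma hloc_eq_of_loc_eq: "loc_eq f p q \<Longrightarrow> hloc_eq f n p q"
  unfolding hloc_eq_def loc_eq_def by (intro bexI [of _ 0]) auto

text \<open>Submodules of the quotient pull back to submodules of the localization, because
  \<open>loc_eq\<close> is finer than \<open>hloc_eq\<close>.\<close>

lemma dsubmod_loc_of_hloc:
  assumes "dsubmod (hloc_eq f n) f n M"
  shows "dsubmod (loc_eq f) f n M"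
proof -
  have "q \<in> M" if "p \<in> M" "q \<in> polys n \<times> UNIV" "loc_eq f p q" for p q
    using dsubmod_saturated [OF assms that(1,2) hloc_eq_of_loc_eq [OF that(3)]] .
  then show ?thesis
    using assms unfolding dsubmod_def by simp
qed

text \<open>For \<open>f = 0\<close> the factor \<open>f ^ 1\<close> identifies all representatives,
  so the localization is the zero module and chains have length 0.\<close>

lemma dsubmod_zero_eq:
  assumes "dsubmod (loc_eq 0) 0 n M"
  shows "M = polys n \<times> UNIV"
proof -
  have "loc_eq 0 p q" for p q :: "'a mpoly \<times> nat"
    unfolding loc_eq_def by (intro exI [of _ 1]) simp
  then show ?thesis
    using dsubmod_saturated [OF assms dsubmod_zero [OF assms]] dsubmod_subset [OF assms] by blast
qed

lemma (in localization) phi_image_V: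
  assumes "dsubmod E f n M"
  shows "phi f ` M \<subseteq> (\<Union>c. V c)"
proof (rule image_subsetI)
  fix p assume "p \<in> M"
  then obtain c where "phi f p \<in> V c"
    using phi_V [OF dsubmod_fst_polys [OF assms]] by blast
  then show "phi f p \<in> (\<Union>c. V c)"
    by blast
qed

lemma loc_chain_length_le:
  fixes f :: "'k::field mpoly"
  assumes f: "f \<in> polys n"
    and N: "\<And>j. j \<le> l \<Longrightarrow> dsubmod (loc_eq f) f n (N j)" "\<And>j. j < l \<Longrightarrow> N j \<subset> N (Suc j)"
  shows "l \<le> (total_deg f + 1) ^ n"
proof (cases "f = 0")
  case True
  have "l = 0"
  proof (rule ccontr)
    assume "l \<noteq> 0"
    then show False
      using N(1) [of 0] N(1) [of 1] N(2) [of 0] True by (auto dest!: dsubmod_zero_eq)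
  qed
  then show ?thesis by simp
next
  case False
  interpret localization f n "total_deg f"
    using False bpolys_total_deg [OF f] by unfold_locales
  show ?thesis
  proof (rule chain_length_le [of l "\<lambda>j. phi f ` N j"])
    fix j assume "j \<le> l"
    then show "phi f ` N j \<subseteq> (\<Union>c. V c)"
      by (rule phi_image_V [OF N(1)])
    from \<open>j \<le> l\<close> show "dsub n (phi f ` N j)"
      by (rule dsub_phi_image [OF False N(1)])
  next
    fix j assume j: "j < l"
    then show "phi f ` N j \<subset> phi f ` N (Suc j)"
      by (intro phi_image_strict [OF False, of n] N) auto
  qed
qed

text \<open>The pullbacks to the localization all contain 1, so \<open>{0}\<close> can be put
  strictly below the first one. The lengthened chain, with \<open>Suc l\<close> steps, obeys the
  bound for the localization.\<close>

lemma hloc_chain_length_less: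
  fixes f :: "'k::field mpoly"
  assumes f: "f \<in> polys n"
    and N: "\<And>j. j \<le> l \<Longrightarrow> dsubmod (hloc_eq f n) f n (N j)" "\<And>j. j < l \<Longrightarrow> N j \<subset> N (Suc j)"
  shows "l < (total_deg f + 1) ^ n"
proof (cases "f = 0")
  case True
  have "l = 0"
  proof (rule ccontr)
    assume "l \<noteq> 0"
    then show False
      using N(1) [of 0] N(1) [of 1] N(2) [of 0] True
      by (auto dest!: dsubmod_loc_of_hloc dsubmod_zero_eq)
  qed
  then show ?thesis by simp
next
  case False
  interpret localization f n "total_deg f"
    using False bpolys_total_deg [OF f] by unfold_locales
  define N' where "N' j = (case j of 0 \<Rightarrow> {0} | Suc i \<Rightarrow> phi f ` N i)" for j
  have "Suc l \<le> (total_deg f + 1) ^ n"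
  proof (rule chain_length_le)
    fix j assume j: "j \<le> Suc l"
    show "dsub n (N' j)"
    proof (cases j)
      case 0
      then show ?thesis
        by (simp add: N'_def dsub_def)
    next
      case (Suc i)
      then show ?thesis
        using j dsub_phi_image [OF False N(1)] unfolding N'_def by simp
    qed
    show "N' j \<subseteq> (\<Union>c. V c)"
    proof (cases j)
      case 0
      then show ?thesis
        using W_zero by (auto simp: N'_def V_def)
    next
      case (Suc i)
      then show ?thesis
        using j phi_image_V [OF N(1)] unfolding N'_def by simp
    qed
  next
    fix j assume j: "j < Suc l"
    show "N' j \<subset> N' (Suc j)"
    proof (cases j)
      case 0
      have N0: "dsubmod (hloc_eq f n) f n (N 0)"
        using N(1) by simp
      \<comment> \<open>The difference \<open>0 - 1\<close> lies in the polynomial ring, hence the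
        witness \<open>- 1\<close>.\<close>
      have "hloc_eq f n (0, 0) (1, 0)"
        unfolding hloc_eq_def by (intro bexI [of _ "- 1"]) (auto simp: loc_eq_def polys_uminus)
      moreover have "(0, 0) \<in> N 0"
        using N0 by (rule dsubmod_zero)
      ultimately have "(1, 0) \<in> N 0"
        using dsubmod_saturated [OF N0, of "(0, 0)" "(1, 0)"] by simp
      then have "phi f (1, 0) \<in> phi f ` N 0"
        by blast
      then have "1 \<in> phi f ` N 0"
        by (simp add: phi_alt False)
      moreover have "0 \<in> phi f ` N 0"
        using dsub_phi_image [OF False N0] by (rule dsub_zero)
      ultimately have "{0} \<subset> phi f ` N 0"
        by (metis empty_subsetI insert_subset psubsetI singletonD zero_neq_one)
      then show ?thesis
        unfolding 0 N'_def by simp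
    next
      case (Suc i)
      with j have "phi f ` N i \<subset> phi f ` N (Suc i)"
        by (intro phi_image_strict [OF False, of n] dsubmod_loc_of_hloc N) auto
      then show ?thesis
        unfolding Suc N'_def by simp
    qed
  qed
  then show ?thesis
    by simp
qed

theorem theorem3p5:
  fixes f :: "'k::field mpoly" and n :: nat
  assumes "f \<in> polys n"
  shows "dlength (loc_eq f) f n \<le> enat ((total_deg f + 1) ^ n)
       \<and> dlength (hloc_eq f n) f n \<le> enat ((total_deg f + 1) ^ n - 1)"
proof
  show "dlength (loc_eq f) f n \<le> enat ((total_deg f + 1) ^ n)"
    unfolding dlength_def
  proof (rule Sup_least)
    fix x assume "x \<in> {enat l | l. \<exists>N. (\<forall>j\<le>l. dsubmod (loc_eq f) f n (N j)) \<and>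
                                        (\<forall>j<l. N j \<subset> N (Suc j))}"
    then obtain l N where "x = enat l" "\<And>j. j \<le> l \<Longrightarrow> dsubmod (loc_eq f) f n (N j)"
      "\<And>j. j < l \<Longrightarrow> N j \<subset> N (Suc j)"
      by blast
    with loc_chain_length_le [OF assms, of l N] show "x \<le> enat ((total_deg f + 1) ^ n)"
      by simp
  qed
  show "dlength (hloc_eq f n) f n \<le> enat ((total_deg f + 1) ^ n - 1)"
    unfolding dlength_def
  proof (rule Sup_least)
    fix x assume "x \<in> {enat l | l. \<exists>N. (\<forall>j\<le>l. dsubmod (hloc_eq f n) f n (N j)) \<and>
                                        (\<forall>j<l. N j \<subset> N (Suc j))}"
    then obtain l N where "x = enat l" "\<And>j. j \<le> l \<Longrightarrow> dsubmod (hloc_eq f n) f n (N j)"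
      "\<And>j. j < l \<Longrightarrow> N j \<subset> N (Suc j)"
      by blast
    with hloc_chain_length_less [OF assms, of l N] show "x \<le> enat ((total_deg f + 1) ^ n - 1)"
      by simp
  qed
qed

end
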